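(* Let $k$ be a field, $k[X]=k[x_1,\dots,x_n]$, let $w=(w_1,\dots,w_n)\in\mathbb{Z}^n$ be an arbitrary integral vector, let $I$ be an ideal of $k[X]$, and let $I^{\mathrm{hom}}\subseteq R:=k[X,t]$ be the homogenization of $I$ with respect to $w$. Then $R/I^{\mathrm{hom}}$ is a flat extension of $k[t]$, i.e. it is flat as a $k[t]$-module.
   Context: Here $t$ is a new indeterminate. For a nonzero polynomial $f=\sum c_ax^a\in k[X]$ set $\deg_wf=\max\{w\cdot a\mid c_a\neq0\}$ and $$f^{\mathrm{hom}}=t^{\deg_wf}\,f\bigl(t^{-w_1}x_1,\dots,t^{-w_n}x_n\bigr)\in k[X,t]$$ (and $0^{\mathrm{hom}}=0$). The homogenization $I^{\mathrm{hom}}$ of $I$ with respect to $w$ is the ideal of $k[X,t]$ generated by all $f^{\mathrm{hom}}$, $f\in I$. *)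

theory Defs
  imports
    "HOL-Algebra.Algebraic_Closure_Type"
    "HOL-Algebra.Free_Abelian_Groups"
    "HOL-Algebra.QuotRing"
    "HOL-Algebra.Module"
begin

section \<open>Flat modules\<close>

definition linear_maps ::
    "('a, 'r) ring_scheme \<Rightarrow> ('a, 'b, 's) module_scheme \<Rightarrow> ('a, 'c, 't) module_scheme \<Rightarrow> ('b \<Rightarrow> 'c) set"
  where "linear_maps A M N =
    {\<phi> \<in> carrier M \<rightarrow> carrier N.
      (\<forall>x\<in>carrier M. \<forall>y\<in>carrier M. \<phi> (x \<oplus>\<^bsub>M\<^esub> y) = \<phi> x \<oplus>\<^bsub>N\<^esub> \<phi> y) \<and>
      (\<forall>a\<in>carrier A. \<forall>x\<in>carrier M. \<phi> (a \<odot>\<^bsub>M\<^esub> x) = a \<odot>\<^bsub>N\<^esub> \<phi> x)}"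

definition tensor_relators ::
    "('a, 'r) ring_scheme \<Rightarrow> ('a, 'b, 's) module_scheme \<Rightarrow> ('a, 'c, 't) module_scheme \<Rightarrow> ('b \<times> 'c \<Rightarrow>\<^sub>0 int) set"
  where "tensor_relators A M N =
      {frag_of (x \<oplus>\<^bsub>M\<^esub> x', y) - frag_of (x, y) - frag_of (x', y) | x x' y.
         x \<in> carrier M \<and> x' \<in> carrier M \<and> y \<in> carrier N}
    \<union> {frag_of (x, y \<oplus>\<^bsub>N\<^esub> y') - frag_of (x, y) - frag_of (x, y') | x y y'.
         x \<in> carrier M \<and> y \<in> carrier N \<and> y' \<in> carrier N}
    \<union> {frag_of (a \<odot>\<^bsub>M\<^esub> x, y) - frag_of (x, a \<odot>\<^bsub>N\<^esub> y) | a x y.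
         a \<in> carrier A \<and> x \<in> carrier M \<and> y \<in> carrier N}"

definition tensor_kernel ::
    "('a, 'r) ring_scheme \<Rightarrow> ('a, 'b, 's) module_scheme \<Rightarrow> ('a, 'c, 't) module_scheme \<Rightarrow> ('b \<times> 'c \<Rightarrow>\<^sub>0 int) set"
  where "tensor_kernel A M N =
    generate (free_Abelian_group (carrier M \<times> carrier N)) (tensor_relators A M N)"

text \<open>The abelian group underlying the tensor product over \<open>A\<close>; its module structure plays no
  role for the injectivity of maps.\<close>

definition tensor_group ::
    "('a, 'r) ring_scheme \<Rightarrow> ('a, 'b, 's) module_scheme \<Rightarrow> ('a, 'c, 't) module_scheme
      \<Rightarrow> ('b \<times> 'c \<Rightarrow>\<^sub>0 int) set monoid"
  where "tensor_group A M N =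
    free_Abelian_group (carrier M \<times> carrier N) Mod tensor_kernel A M N"

text \<open>The map from the tensor product of \<open>M\<close> and \<open>N\<close> to that of \<open>M\<close> and \<open>N'\<close> induced by the
  identity of \<open>M\<close> and \<open>\<phi> : N \<rightarrow> N'\<close>. The union is over equal cosets; see \<open>tensor_map_coset\<close>.\<close>

definition tensor_map ::
    "('a, 'r) ring_scheme \<Rightarrow> ('a, 'b, 's) module_scheme \<Rightarrow> ('a, 'd, 't) module_scheme \<Rightarrow> ('c \<Rightarrow> 'd)
      \<Rightarrow> ('b \<times> 'c \<Rightarrow>\<^sub>0 int) set \<Rightarrow> ('b \<times> 'd \<Rightarrow>\<^sub>0 int) set"
  where "tensor_map A M N' \<phi> C =
    (\<Union>c\<in>C. tensor_kernel A M N' #>\<^bsub>free_Abelian_group (carrier M \<times> carrier N')\<^esub>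
       frag_extend (\<lambda>(x, y). frag_of (x, \<phi> y)) c)"

text \<open>Flatness: tensoring with \<open>M\<close> preserves injectivity of linear maps. HOL cannot quantify over
  types inside a formula, so the element types of the test modules are parameters. A theorem
  that leaves them as type variables asserts the property for test modules of all types.\<close>

definition flat_module ::
    "('a, 'r) ring_scheme \<Rightarrow> ('a, 'b, 's) module_scheme \<Rightarrow> 'c itself \<Rightarrow> 'd itself \<Rightarrow> bool"
  where "flat_module A M _ _ \<longleftrightarrow>
    Module.module A M \<and>
    (\<forall>(N :: ('a, 'c) module) (N' :: ('a, 'd) module) \<phi>.
       Module.module A N \<and> Module.module A N' \<and> \<phi> \<in> linear_maps A N N' \<and> inj_on \<phi> (carrier N)
       \<longrightarrow> inj_on (tensor_map A M N' \<phi>) (carrier (tensor_group A M N)))"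

definition module_via :: "('b, 's) ring_scheme \<Rightarrow> ('a \<Rightarrow> 'b) \<Rightarrow> ('a, 'b) module"
  where "module_via S h =
    \<lparr>carrier = carrier S, monoid.mult = monoid.mult S, one = one S, ring.zero = ring.zero S, add = add S,
     module.smult = (\<lambda>a x. h a \<otimes>\<^bsub>S\<^esub> x)\<rparr>"

definition flat_extension ::
    "('a, 'r) ring_scheme \<Rightarrow> ('b, 's) ring_scheme \<Rightarrow> ('a \<Rightarrow> 'b) \<Rightarrow> 'c itself \<Rightarrow> 'd itself \<Rightarrow> bool"
  where "flat_extension A S h C D \<longleftrightarrow>
    h \<in> ring_hom A S \<and> flat_module A (module_via S h) C D"

lemma tensor_relators_subset:
  assumes "Module.module A M" "Module.module A N"
  shows "tensor_relators A M N \<subseteq> carrier (free_Abelian_group (carrier M \<times> carrier N))"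
proof -
  interpret M: Module.module A M by fact
  interpret N: Module.module A N by fact
  show ?thesis
    unfolding tensor_relators_def by (auto dest!: keys_diff[THEN subsetD])
qed

lemma frag_extend_in_tensor_kernel:
  fixes M :: "('a, 'b, 's) module_scheme" and N :: "('a, 'c, 't) module_scheme"
    and N' :: "('a, 'd, 'u) module_scheme"
  assumes "Module.module A M" "Module.module A N" "Module.module A N'"
    and phi: "\<phi> \<in> linear_maps A N N'"
    and c: "c \<in> tensor_kernel A M N"
  shows "frag_extend (\<lambda>(x, y). frag_of (x, \<phi> y)) c \<in> tensor_kernel A M N'"
proof -
  interpret M: Module.module A M by fact
  interpret N: Module.module A N by fact
  interpret N': Module.module A N' by fact
  let ?F = "free_Abelian_group (carrier M \<times> carrier N)"
  let ?F' = "free_Abelian_group (carrier M \<times> carrier N')"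
  let ?g = "frag_extend (\<lambda>(x, y). frag_of (x, \<phi> y))"
  have rel: "?g r \<in> tensor_relators A M N'" if "r \<in> tensor_relators A M N" for r
    using that phi N.smult_closed unfolding tensor_relators_def linear_maps_def
    by (auto simp: frag_extend_diff Pi_iff; metis)
  have relF: "tensor_relators A M N \<subseteq> carrier ?F"
    using assms(1,2) by (rule tensor_relators_subset)
  show ?thesis using c unfolding tensor_kernel_def
  proof (induction c rule: generate.induct)
    case one
    show ?case using generate.one[of ?F'] by simp
  next
    case (incl h)
    then show ?case using rel by (blast intro: generate.incl)
  next
    case (inv h)
    have relF': "tensor_relators A M N' \<subseteq> carrier ?F'"
      using assms(1,3) by (rule tensor_relators_subset)
    have "inv\<^bsub>?F'\<^esub> (?g h) \<in> generate ?F' (tensor_relators A M N')"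
      using inv rel by (blast intro: generate.inv)
    moreover have "inv\<^bsub>?F'\<^esub> (?g h) = - ?g h" "inv\<^bsub>?F\<^esub> h = - h"
      using relF relF' rel[OF inv] inv by (auto simp: subset_iff)
    ultimately show ?case by (simp add: frag_extend_minus)
  next
    case (eng h1 h2)
    then show ?case using generate.eng[of _ ?F'] by (fastforce simp: frag_extend_add)
  qed
qed

lemma tensor_map_coset:
  fixes M :: "('a, 'b, 's) module_scheme" and N :: "('a, 'c, 't) module_scheme"
    and N' :: "('a, 'd, 'u) module_scheme"
  assumes "Module.module A M" "Module.module A N" "Module.module A N'"
    and "\<phi> \<in> linear_maps A N N'"
    and c: "c \<in> carrier (free_Abelian_group (carrier M \<times> carrier N))"
  shows "tensor_map A M N' \<phi>
           (tensor_kernel A M N #>\<^bsub>free_Abelian_group (carrier M \<times> carrier N)\<^esub> c) =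
         tensor_kernel A M N' #>\<^bsub>free_Abelian_group (carrier M \<times> carrier N')\<^esub>
           frag_extend (\<lambda>(x, y). frag_of (x, \<phi> y)) c"
proof -
  interpret M: Module.module A M by fact
  interpret N': Module.module A N' by fact
  let ?F = "free_Abelian_group (carrier M \<times> carrier N)"
  let ?F' = "free_Abelian_group (carrier M \<times> carrier N')"
  interpret F': group ?F' by simp
  let ?g = "frag_extend (\<lambda>(x, y). frag_of (x, \<phi> y))"
  have "tensor_relators A M N' \<subseteq> carrier ?F'"
    using assms(1,3) by (rule tensor_relators_subset)
  then have sub: "subgroup (tensor_kernel A M N') ?F'"
    unfolding tensor_kernel_def by (rule F'.generate_is_subgroup)
  have K: "tensor_kernel A M N' #>\<^bsub>?F'\<^esub> (k + d) = tensor_kernel A M N' #>\<^bsub>?F'\<^esub> d"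
    if "k \<in> tensor_kernel A M N'" for k d
  proof -
    have "(\<lambda>x. x + k) ` tensor_kernel A M N' = tensor_kernel A M N'"
    proof (intro equalityI subsetI)
      fix y assume "y \<in> (\<lambda>x. x + k) ` tensor_kernel A M N'"
      then show "y \<in> tensor_kernel A M N'"
        using subgroup.m_closed[OF sub] that by auto
    next
      fix y assume y: "y \<in> tensor_kernel A M N'"
      have "k \<in> carrier ?F'" using that sub subgroup.mem_carrier by metis
      then have "y - k \<in> tensor_kernel A M N'"
        using subgroup.m_closed[OF sub y subgroup.m_inv_closed[OF sub that]] by simp
      then show "y \<in> (\<lambda>x. x + k) ` tensor_kernel A M N'"
        by (metis diff_add_cancel image_eqI)
    qed
    then have "(\<lambda>x. x + d) ` (\<lambda>x. x + k) ` tensor_kernel A M N' = (\<lambda>x. x + d) ` tensor_kernel A M N'"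
      by simp
    then show ?thesis
      by (simp add: r_coset_def image_image add.assoc UNION_singleton_eq_range)
  qed
  have "0 \<in> tensor_kernel A M N"
    unfolding tensor_kernel_def using generate.one[of ?F] by simp
  then show ?thesis
    unfolding tensor_map_def r_coset_def[of ?F]
    using K[OF frag_extend_in_tensor_kernel[OF assms(1-4)]]
    by (auto simp: frag_extend_add)
qed

section \<open>Homogenization with respect to an integral weight vector\<close>

text \<open>\<open>k[X]\<close>, with variables indexed by a finite type of \<open>n\<close> elements: finitely supported
  functions from exponent vectors to coefficients.\<close>

type_synonym ('n, 'k) mpoly = "('n \<Rightarrow>\<^sub>0 nat) \<Rightarrow>\<^sub>0 'k"

definition weight :: "('n::finite \<Rightarrow> int) \<Rightarrow> ('n \<Rightarrow>\<^sub>0 nat) \<Rightarrow> int"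
  where "weight w a = (\<Sum>i\<in>UNIV. w i * int (Poly_Mapping.lookup a i))"

definition wdeg :: "('n::finite \<Rightarrow> int) \<Rightarrow> ('n, 'k::zero) mpoly \<Rightarrow> int"
  where "wdeg w f = Max (weight w ` Poly_Mapping.keys f)"

text \<open>\<open>k[X,t]\<close> is \<open>k[X][t]\<close>. Expanding \<open>t\<^bsup>deg f\<^esup> f(t\<^bsup>-w\<^sub>1\<^esup> x\<^sub>1, \<dots>, t\<^bsup>-w\<^sub>n\<^esup> x\<^sub>n)\<close>
  gives the sum of \<open>c\<^sub>a x\<^sup>a t\<^bsup>deg f - w \<cdot> a\<^esup>\<close>, whose exponents of \<open>t\<close> are nonnegative;
  see \<open>homogenize_laurent\<close> for the unexpanded formula.\<close>

definition homogenize :: "('n::finite \<Rightarrow> int) \<Rightarrow> ('n, 'k::comm_ring_1) mpoly \<Rightarrow> ('n, 'k) mpoly poly"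
  where "homogenize w f =
    (\<Sum>a\<in>Poly_Mapping.keys f.
       Polynomial.monom (Poly_Mapping.single a (Poly_Mapping.lookup f a)) (nat (wdeg w f - weight w a)))"

definition homogenization :: "('n::finite \<Rightarrow> int) \<Rightarrow> ('n, 'k::comm_ring_1) mpoly set \<Rightarrow> ('n, 'k) mpoly poly set"
  where "homogenization w I = genideal ring_of_type_algebra (homogenize w ` I)"

text \<open>The inclusion of \<open>k[t]\<close> in \<open>k[X][t]\<close>.\<close>

definition univariate_incl :: "'k::comm_ring_1 poly \<Rightarrow> ('n, 'k) mpoly poly"
  where "univariate_incl = map_poly (Poly_Mapping.single 0)"

lemma fls_const_prod:
  "fls_const (\<Prod>i\<in>A. f i :: 'a::comm_ring_1) = (\<Prod>i\<in>A. fls_const (f i))"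
  by (induction A rule: infinite_finite_induct) (auto simp flip: fls_const_mult_const)

lemma fls_X_intpow_prod:
  "(\<Prod>i\<in>A. fls_X_intpow (f i) :: 'a::comm_ring_1 fls) = fls_X_intpow (\<Sum>i\<in>A. f i)"
proof (induction A rule: infinite_finite_induct)
  case (insert x F)
  then show ?case
    using fls_X_intpow_times_fls_X_intpow[of "f x" "sum f F", where 'a = 'a] by simp
qed simp_all

lemma homogenize_laurent:
  fixes f :: "('n::finite, 'k::comm_ring_1) mpoly"
  shows "fps_to_fls (fps_of_poly (homogenize w f)) =
    fls_X_intpow (wdeg w f) *
    (\<Sum>a\<in>Poly_Mapping.keys f. fls_const (Poly_Mapping.single 0 (Poly_Mapping.lookup f a)) *
       (\<Prod>i\<in>UNIV. (fls_X_intpow (- w i) * fls_const (Poly_Mapping.single (Poly_Mapping.single i 1) 1))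
          ^ Poly_Mapping.lookup a i))"
proof -
  have single_power: "Poly_Mapping.single (Poly_Mapping.single i 1) 1 ^ m =
      Poly_Mapping.single (Poly_Mapping.single i m) (1 :: 'k)" for i :: 'n and m
    by (induction m) (simp_all add: mult_single flip: single_add)
  have single_prod: "(\<Prod>i\<in>A. Poly_Mapping.single (Poly_Mapping.single i (m i)) (1 :: 'k)) =
      Poly_Mapping.single (\<Sum>i\<in>A. Poly_Mapping.single i (m i)) 1"
    for A :: "'n set" and m :: "'n \<Rightarrow> nat"
    by (induction A rule: infinite_finite_induct) (simp_all add: mult_single)
  have sum_single: "(\<Sum>i\<in>UNIV. Poly_Mapping.single i (Poly_Mapping.lookup a i)) = a" for a :: "'n \<Rightarrow>\<^sub>0 nat"
    by (rule poly_mapping_eqI) (simp add: lookup_sum lookup_single when_def)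
  have factor: "(\<Prod>i\<in>UNIV. (fls_X_intpow (- w i) * fls_const (Poly_Mapping.single (Poly_Mapping.single i 1) (1::'k)))
          ^ Poly_Mapping.lookup a i) = fls_X_intpow (- weight w a) * fls_const (Poly_Mapping.single a 1)"
    for a
    unfolding power_mult_distrib prod.distrib fls_X_intpow_power fls_X_intpow_prod
      fls_const_power[symmetric] fls_const_prod[symmetric] single_power single_prod sum_single
    by (simp add: weight_def sum_negf mult.commute)
  have le: "weight w a \<le> wdeg w f" if "a \<in> Poly_Mapping.keys f" for a
    using that by (simp add: wdeg_def)
  have fps_to_fls_sum: "fps_to_fls (sum g A) = (\<Sum>a\<in>A. fps_to_fls (g a))"
    for A :: "('n \<Rightarrow>\<^sub>0 nat) set" and g :: "_ \<Rightarrow> ('n, 'k) mpoly fps"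
    by (induction A rule: infinite_finite_induct) auto
  have "fps_to_fls (fps_of_poly (homogenize w f)) =
    (\<Sum>a\<in>Poly_Mapping.keys f. fls_const (Poly_Mapping.single a (Poly_Mapping.lookup f a)) *
       fls_X_intpow (wdeg w f - weight w a))"
    unfolding homogenize_def fps_of_poly_sum fps_to_fls_sum
    by (intro sum.cong refl)
       (simp add: fps_of_poly_monom fls_times_fps_to_fls fps_to_fls_power fls_X_power_conv_shift_1 le)
  also have "\<dots> = fls_X_intpow (wdeg w f) * (\<Sum>a\<in>Poly_Mapping.keys f.
      fls_const (Poly_Mapping.single 0 (Poly_Mapping.lookup f a)) *
      (fls_X_intpow (- weight w a) * fls_const (Poly_Mapping.single a 1)))"
    unfolding sum_distrib_left
  proof (intro sum.cong refl)
    fix a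
    have 1: "fls_const (Poly_Mapping.single a (Poly_Mapping.lookup f a)) =
        fls_const (Poly_Mapping.single 0 (Poly_Mapping.lookup f a)) * fls_const (Poly_Mapping.single a 1)"
      by (simp add: fls_const_mult_const mult_single)
    have 2: "(fls_X_intpow (wdeg w f - weight w a) :: ('n, 'k) mpoly fls) =
        fls_X_intpow (wdeg w f) * fls_X_intpow (- weight w a)"
      by (rule fls_X_intpow_diff_conv_times)
    show "fls_const (Poly_Mapping.single a (Poly_Mapping.lookup f a)) *
         fls_X_intpow (wdeg w f - weight w a) =
         fls_X_intpow (wdeg w f) *
         (fls_const (Poly_Mapping.single 0 (Poly_Mapping.lookup f a)) *
          (fls_X_intpow (- weight w a) * fls_const (Poly_Mapping.single a 1)))"
      unfolding 1 2 by (simp only: mult_ac)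
  qed
  finally show ?thesis by (simp only: factor)
qed

end

theory Submission
  imports Defs
begin

text \<open>A torsion-free module over a Euclidean domain is flat: each finite set of its elements lies in
  the span of a finite independent family, and finitely many relators suffice to make a tensor
  vanish, so injectivity can be tested on coordinates.

  Give \<open>t\<close> weight 1. A polynomial lies in \<open>I\<^sup>h\<^sup>o\<^sup>m\<close> iff all its weighted-homogeneous components,
  evaluated at \<open>t = 1\<close>, lie in \<open>I\<close>. Hence the quotient is torsion-free over \<open>k[t]\<close>: if \<open>p g\<close> lies
  in \<open>I\<^sup>h\<^sup>o\<^sup>m\<close> and \<open>p \<noteq> 0\<close>, compare the lowest component of \<open>g\<close> outside \<open>I\<close> with the lowest nonzero
  coefficient of \<open>p\<close>.\<close>

section \<open>Independent families in torsion-free modules\<close>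

text \<open>A torsion-free module need not be free, so there are in general no global coordinates on
  \<open>M\<close>; they exist only on the span of a finite independent family. The resulting
  functionals are linear on that span and uncontrolled elsewhere, so they do not induce maps on the
  tensor product. They do induce homomorphisms on the free abelian group of pairs, where no
  linearity is asked for, and these kill every relator whose entries from \<open>M\<close> lie in
  the span. This is why the finite set is chosen only after a certificate of vanishing is fixed: it
  has to contain the entries of the relators used there.

  For the quotient, setting \<open>t = 1\<close> in one weighted-homogeneous component loses
  nothing, because in weight \<open>d\<close> the exponent of \<open>t\<close> next to
  \<open>x^a\<close> is forced to be \<open>d - w . a\<close>. The entries of \<open>w\<close> may
  be negative, so weights are not bounded below; a lowest bad component exists because a single
  polynomial has only finitely many nonzero components.\<close>

context module
begin

definition span_family :: "'i set \<Rightarrow> ('i \<Rightarrow> 'c) \<Rightarrow> 'c set"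
  where "span_family J v = {\<Oplus>\<^bsub>M\<^esub>i\<in>J. c i \<odot>\<^bsub>M\<^esub> v i | c. c \<in> J \<rightarrow> carrier R}"

definition independent_family :: "'i set \<Rightarrow> ('i \<Rightarrow> 'c) \<Rightarrow> bool"
  where "independent_family J v \<longleftrightarrow>
    (\<forall>c\<in>J \<rightarrow> carrier R. (\<Oplus>\<^bsub>M\<^esub>i\<in>J. c i \<odot>\<^bsub>M\<^esub> v i) = \<zero>\<^bsub>M\<^esub> \<longrightarrow> (\<forall>i\<in>J. c i = \<zero>))"

text \<open>The extra term \<open>c i q v j\<close> created in the \<open>i\<close>-th summand
  cancels against the one removed from the \<open>j\<close>-th. This is the elementary move by which
  Euclidean division on the coefficients of a relation is compensated by a change of
  generators.\<close>

lemma lincomb_exchange: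
  assumes "finite J" "i \<in> J" "j \<in> J" "i \<noteq> j" "v \<in> J \<rightarrow> carrier M" "c \<in> J \<rightarrow> carrier R" "q \<in> carrier R"
  shows "(\<Oplus>\<^bsub>M\<^esub>l\<in>J. c l \<odot>\<^bsub>M\<^esub> v l) =
    (\<Oplus>\<^bsub>M\<^esub>l\<in>J. (c(j := c j \<ominus> q \<otimes> c i)) l \<odot>\<^bsub>M\<^esub> (v(i := v i \<oplus>\<^bsub>M\<^esub> q \<odot>\<^bsub>M\<^esub> v j)) l)"
proof -
  define K where "K = J - {i, j}"
  have J: "J = insert i (insert j K)" and K: "finite K" "i \<notin> insert j K" "j \<notin> K"
    using assms by (auto simp: K_def)
  have vc [simp]: "v i \<in> carrier M" "v j \<in> carrier M" "c i \<in> carrier R" "c j \<in> carrier R"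
    "v \<in> K \<rightarrow> carrier M" "c \<in> K \<rightarrow> carrier R" "q \<in> carrier R"
    using assms by (auto simp: K_def)
  have cv [simp]: "(\<lambda>l. c l \<odot>\<^bsub>M\<^esub> v l) \<in> K \<rightarrow> carrier M"
    using vc(5,6) by (auto simp: Pi_iff)
  let ?S = "\<Oplus>\<^bsub>M\<^esub>l\<in>K. c l \<odot>\<^bsub>M\<^esub> v l"
  have S: "(\<Oplus>\<^bsub>M\<^esub>l\<in>K. (c(j := c j \<ominus> q \<otimes> c i)) l \<odot>\<^bsub>M\<^esub> (v(i := v i \<oplus>\<^bsub>M\<^esub> q \<odot>\<^bsub>M\<^esub> v j)) l) = ?S"
    by (rule M.finsum_cong') (use K in auto)
  have cv': "(\<lambda>l. (c(j := c j \<ominus> q \<otimes> c i)) l \<odot>\<^bsub>M\<^esub> (v(i := v i \<oplus>\<^bsub>M\<^esub> q \<odot>\<^bsub>M\<^esub> v j)) l) \<in> K \<rightarrow> carrier M"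
    using K vc(5,6) by (auto simp: Pi_iff)
  have "(\<Oplus>\<^bsub>M\<^esub>l\<in>J. (c(j := c j \<ominus> q \<otimes> c i)) l \<odot>\<^bsub>M\<^esub> (v(i := v i \<oplus>\<^bsub>M\<^esub> q \<odot>\<^bsub>M\<^esub> v j)) l)
      = c i \<odot>\<^bsub>M\<^esub> (v i \<oplus>\<^bsub>M\<^esub> q \<odot>\<^bsub>M\<^esub> v j) \<oplus>\<^bsub>M\<^esub> ((c j \<ominus> q \<otimes> c i) \<odot>\<^bsub>M\<^esub> v j \<oplus>\<^bsub>M\<^esub> ?S)"
    using K assms(4) cv' unfolding J by (simp add: M.finsum_insert S[unfolded fun_upd_def] Pi_iff fun_upd_def)
  also have "\<dots> = c i \<odot>\<^bsub>M\<^esub> v i \<oplus>\<^bsub>M\<^esub> (c j \<odot>\<^bsub>M\<^esub> v j \<oplus>\<^bsub>M\<^esub> ?S)"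
  proof -
    have "(c j \<ominus> q \<otimes> c i) \<odot>\<^bsub>M\<^esub> v j = c j \<odot>\<^bsub>M\<^esub> v j \<oplus>\<^bsub>M\<^esub> (\<ominus>\<^bsub>M\<^esub> ((c i \<otimes> q) \<odot>\<^bsub>M\<^esub> v j))"
      by (simp add: R.minus_eq smult_l_distr smult_l_minus R.m_comm)
    moreover have "c i \<odot>\<^bsub>M\<^esub> (v i \<oplus>\<^bsub>M\<^esub> q \<odot>\<^bsub>M\<^esub> v j) = c i \<odot>\<^bsub>M\<^esub> v i \<oplus>\<^bsub>M\<^esub> (c i \<otimes> q) \<odot>\<^bsub>M\<^esub> v j"
      by (simp add: smult_r_distr smult_assoc1)
    ultimately show ?thesis
      by (simp add: M.a_assoc M.r_neg1 M.r_neg2 M.a_lcomm[of "c j \<odot>\<^bsub>M\<^esub> v j"] M.finsum_closed)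
  qed
  also have "\<dots> = (\<Oplus>\<^bsub>M\<^esub>l\<in>J. c l \<odot>\<^bsub>M\<^esub> v l)"
    using K cv unfolding J by (simp add: M.finsum_insert Pi_iff)
  finally show ?thesis ..
qed

text \<open>One inclusion suffices: the changed family only has to go on spanning a given finite
  set.\<close>

lemma span_family_exchange:
  assumes "finite J" "i \<in> J" "j \<in> J" "i \<noteq> j" "v \<in> J \<rightarrow> carrier M" "q \<in> carrier R"
  shows "span_family J v \<subseteq> span_family J (v(i := v i \<oplus>\<^bsub>M\<^esub> q \<odot>\<^bsub>M\<^esub> v j))"
proof
  fix x assume "x \<in> span_family J v"
  then obtain c where c: "c \<in> J \<rightarrow> carrier R" "x = (\<Oplus>\<^bsub>M\<^esub>l\<in>J. c l \<odot>\<^bsub>M\<^esub> v l)"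
    by (auto simp: span_family_def)
  then show "x \<in> span_family J (v(i := v i \<oplus>\<^bsub>M\<^esub> q \<odot>\<^bsub>M\<^esub> v j))"
    unfolding span_family_def using lincomb_exchange[OF assms(1-5) c(1) assms(6)] assms
    by (intro CollectI exI[of _ "c(j := c j \<ominus> q \<otimes> c i)"]) (auto simp: Pi_iff)
qed

lemma finsum_single_nonzero:
  assumes "finite J" "i \<in> J" "f i \<in> carrier M" "\<And>l. l \<in> J - {i} \<Longrightarrow> f l = \<zero>\<^bsub>M\<^esub>"
  shows "(\<Oplus>\<^bsub>M\<^esub>l\<in>J. f l) = f i"
proof -
  have "insert i (J - {i}) = J" using assms by auto
  moreover have "(\<Oplus>\<^bsub>M\<^esub>l\<in>J - {i}. f l) = \<zero>\<^bsub>M\<^esub>"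
    using assms by (intro M.add.finprod_one_eqI) auto
  moreover have "(\<Oplus>\<^bsub>M\<^esub>l\<in>insert i (J - {i}). f l) = f i \<oplus>\<^bsub>M\<^esub> (\<Oplus>\<^bsub>M\<^esub>l\<in>J - {i}. f l)"
    using assms by (intro M.finsum_insert) auto
  ultimately show ?thesis using assms by simp
qed

lemma span_family_remove_zero:
  assumes "finite J" "i \<in> J" "v i = \<zero>\<^bsub>M\<^esub>" "v \<in> J \<rightarrow> carrier M"
  shows "span_family J v \<subseteq> span_family (J - {i}) v"
proof
  fix x assume "x \<in> span_family J v"
  then obtain c where c: "c \<in> J \<rightarrow> carrier R" "x = (\<Oplus>\<^bsub>M\<^esub>l\<in>J. c l \<odot>\<^bsub>M\<^esub> v l)"
    by (auto simp: span_family_def)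
  have J: "insert i (J - {i}) = J" using assms by auto
  have "(\<Oplus>\<^bsub>M\<^esub>l\<in>insert i (J - {i}). c l \<odot>\<^bsub>M\<^esub> v l) = c i \<odot>\<^bsub>M\<^esub> v i \<oplus>\<^bsub>M\<^esub> (\<Oplus>\<^bsub>M\<^esub>l\<in>J - {i}. c l \<odot>\<^bsub>M\<^esub> v l)"
    using assms c by (intro M.finsum_insert) auto
  moreover have "(\<Oplus>\<^bsub>M\<^esub>l\<in>J - {i}. c l \<odot>\<^bsub>M\<^esub> v l) \<in> carrier M"
    using assms c by (intro M.finsum_closed) auto
  ultimately have "x = (\<Oplus>\<^bsub>M\<^esub>l\<in>J - {i}. c l \<odot>\<^bsub>M\<^esub> v l)"
    using c assms J by (auto simp: Pi_iff)
  then show "x \<in> span_family (J - {i}) v"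
    using c by (auto simp: span_family_def)
qed

lemma subset_span_family_id:
  assumes "finite F" "F \<subseteq> carrier M"
  shows "F \<subseteq> span_family F (\<lambda>x. x)"
proof
  fix x assume x: "x \<in> F"
  have "(\<Oplus>\<^bsub>M\<^esub>y\<in>F. (if y = x then \<one> else \<zero>) \<odot>\<^bsub>M\<^esub> y) = (if x = x then \<one> else \<zero>) \<odot>\<^bsub>M\<^esub> x"
    using x assms by (intro finsum_single_nonzero) auto
  then have "x = (\<Oplus>\<^bsub>M\<^esub>y\<in>F. (if y = x then \<one> else \<zero>) \<odot>\<^bsub>M\<^esub> y)"
    using x assms by auto
  then show "x \<in> span_family F (\<lambda>x. x)"
    unfolding span_family_def by (intro CollectI exI[of _ "\<lambda>y. if y = x then \<one> else \<zero>"]) auto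
qed

text \<open>In a generating family of minimal cardinality, Euclidean division applied to the coefficients
  of a nontrivial relation ends in a relation with a single nonzero coefficient, whose generator
  is then zero and can be dropped.\<close>

lemma finite_subset_span_independent:
  assumes euclid: "euclidean_domain R \<phi>"
    and torsion_free: "\<And>a x. \<lbrakk>a \<in> carrier R; x \<in> carrier M; a \<odot>\<^bsub>M\<^esub> x = \<zero>\<^bsub>M\<^esub>\<rbrakk> \<Longrightarrow> a = \<zero> \<or> x = \<zero>\<^bsub>M\<^esub>"
    and F: "finite F" "F \<subseteq> carrier M"
  obtains J :: "'c set" and v
  where "finite J" "v \<in> J \<rightarrow> carrier M" "F \<subseteq> span_family J v" "independent_family J v"
proof -
  interpret euclidean_domain R \<phi> by fact
  define P where "P J v \<longleftrightarrow> finite J \<and> v \<in> J \<rightarrow> carrier M \<and> F \<subseteq> span_family J v" for J :: "'c set" and v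
  \<comment> \<open>\<open>F\<close> indexed by itself is a first spanning family; hence index sets
    inside the element type of \<open>M\<close> are enough.\<close>
  have "\<exists>J. \<exists>v. P J v"
    using F subset_span_family_id[OF F] by (intro exI[of _ F] exI[of _ "\<lambda>x. x"]) (auto simp: P_def)
  then obtain J where ex: "\<exists>v. P J v" and least: "\<And>J'. \<exists>v. P J' v \<Longrightarrow> card J \<le> card J'"
    using ex_has_least_nat[of "\<lambda>J. \<exists>v. P J v" _ card] by blast
  obtain v where v: "P J v" using ex by blast
  \<comment> \<open>The shift by \<open>Suc\<close> makes zero strictly smaller than every nonzero
    coefficient, including those of Euclidean size 0, so the measure also drops when a division
    leaves no remainder.\<close>
  define \<mu> where "\<mu> a = (if a = \<zero> then 0 else Suc (\<phi> a))" for a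
  \<comment> \<open>The minimal index set \<open>J\<close> stays fixed, while the family and the
    relation vary: an exchange yields another spanning family over the same
    \<open>J\<close>.\<close>
  have trivial: "\<forall>i\<in>J. a i = \<zero>"
    if "P J v" "a \<in> J \<rightarrow> carrier R" "(\<Oplus>\<^bsub>M\<^esub>i\<in>J. a i \<odot>\<^bsub>M\<^esub> v i) = \<zero>\<^bsub>M\<^esub>" for v a
    using that
  proof (induction "\<Sum>i\<in>J. \<mu> (a i)" arbitrary: v a rule: less_induct)
    case less
    have J: "finite J" "v \<in> J \<rightarrow> carrier M" "F \<subseteq> span_family J v"
      using less.prems(1) by (auto simp: P_def)
    show ?case
    proof (rule ccontr)
      assume "\<not> ?thesis"
      then obtain i where i: "i \<in> J" "a i \<noteq> \<zero>" by blast
      show False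
      proof (cases "\<exists>j\<in>J. j \<noteq> i \<and> a j \<noteq> \<zero>")
        case True
        \<comment> \<open>By symmetry the coefficient of smaller size is taken as the divisor, so
          that the remainder is smaller than the coefficient it replaces.\<close>
        then obtain i j where ij: "i \<in> J" "j \<in> J" "i \<noteq> j" "a i \<noteq> \<zero>" "a j \<noteq> \<zero>" "\<phi> (a i) \<le> \<phi> (a j)"
          using i by (metis nat_le_linear)
        then have "a i \<in> carrier R" "a j \<in> carrier R" using less.prems by auto
        then obtain q r where qr: "q \<in> carrier R" "r \<in> carrier R" "a j = a i \<otimes> q \<oplus> r"
          "r = \<zero> \<or> \<phi> r < \<phi> (a i)"
          using euclidean_function[of "a j" "a i"] ij by auto
        have r: "a j \<ominus> q \<otimes> a i = r"
          using qr \<open>a i \<in> carrier R\<close> by (simp add: R.minus_eq R.m_comm R.a_ac R.r_neg)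
        let ?v = "v(i := v i \<oplus>\<^bsub>M\<^esub> q \<odot>\<^bsub>M\<^esub> v j)"
        have "P J ?v"
          using J span_family_exchange[OF J(1) ij(1-3) J(2) qr(1)] ij qr
          by (auto simp: P_def Pi_iff)
        moreover have "(\<Oplus>\<^bsub>M\<^esub>l\<in>J. (a(j := r)) l \<odot>\<^bsub>M\<^esub> ?v l) = \<zero>\<^bsub>M\<^esub>"
          using lincomb_exchange[OF J(1) ij(1-3) J(2) less.prems(2) qr(1)] less.prems(3) r by simp
        moreover have "(\<Sum>l\<in>J. \<mu> ((a(j := r)) l)) < (\<Sum>l\<in>J. \<mu> (a l))"
          using ij qr J(1) by (intro sum_strict_mono_ex1) (auto simp: \<mu>_def intro!: bexI[of _ j])
        moreover have "a(j := r) \<in> J \<rightarrow> carrier R" using less.prems qr by auto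
        ultimately have "\<forall>l\<in>J. (a(j := r)) l = \<zero>" by (intro less.hyps)
        then show False using ij by auto
      next
        case False
        have "(\<Oplus>\<^bsub>M\<^esub>l\<in>J. a l \<odot>\<^bsub>M\<^esub> v l) = a i \<odot>\<^bsub>M\<^esub> v i"
          using False less.prems(2) J i by (intro finsum_single_nonzero) (auto simp: Pi_iff)
        then have "v i = \<zero>\<^bsub>M\<^esub>"
          using torsion_free[of "a i" "v i"] less.prems J i by auto
        then have "P (J - {i}) v"
          using span_family_remove_zero[OF J(1) i(1) _ J(2)] J by (auto simp: P_def)
        then have "card J \<le> card (J - {i})" using least by blast
        then show False using i J(1) by (metis card_Diff1_less not_le)
      qed
    qed
  qed
  show ?thesis
    using that[of J v] v trivial by (auto simp: P_def independent_family_def)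
qed

text \<open>Uniqueness of coefficients turns a mere choice of them into linear functions on the
  span. The functions are total with values in \<open>R\<close>, but nothing beyond that is known
  off the span; \<open>tensor_kernel_finite_support\<close> is designed for such partially linear
  functionals.\<close>

lemma independent_family_coordinates:
  assumes J: "finite J" "v \<in> J \<rightarrow> carrier M" "independent_family J v"
  obtains \<beta> where
    "\<And>i x. \<beta> i x \<in> carrier R"
    "\<And>x. x \<in> span_family J v \<Longrightarrow> x = (\<Oplus>\<^bsub>M\<^esub>i\<in>J. \<beta> i x \<odot>\<^bsub>M\<^esub> v i)"
    "\<And>i x y. \<lbrakk>i \<in> J; x \<in> span_family J v; y \<in> span_family J v\<rbrakk> \<Longrightarrow> \<beta> i (x \<oplus>\<^bsub>M\<^esub> y) = \<beta> i x \<oplus> \<beta> i y"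
    "\<And>i a x. \<lbrakk>i \<in> J; a \<in> carrier R; x \<in> span_family J v\<rbrakk> \<Longrightarrow> \<beta> i (a \<odot>\<^bsub>M\<^esub> x) = a \<otimes> \<beta> i x"
proof -
  let ?L = "\<lambda>c. \<Oplus>\<^bsub>M\<^esub>i\<in>J. c i \<odot>\<^bsub>M\<^esub> v i"
  have v: "v i \<in> carrier M" if "i \<in> J" for i using J that by auto
  have "\<exists>c. (\<forall>i. c i \<in> carrier R) \<and> (x \<in> span_family J v \<longrightarrow> x = ?L c)" for x
  proof (cases "x \<in> span_family J v")
    case True
    then obtain c where c: "c \<in> J \<rightarrow> carrier R" "x = ?L c" by (auto simp: span_family_def)
    moreover have "?L c = ?L (\<lambda>i. if i \<in> J then c i else \<zero>)"
      using v c by (intro M.finsum_cong') (auto simp: Pi_iff)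
    ultimately show ?thesis by (intro exI[of _ "\<lambda>i. if i \<in> J then c i else \<zero>"]) auto
  qed auto
  then obtain \<gamma> where \<gamma>: "\<And>x i. \<gamma> x i \<in> carrier R" "\<And>x. x \<in> span_family J v \<Longrightarrow> x = ?L (\<gamma> x)"
    by metis
  have L_add: "?L (\<lambda>i. c i \<oplus> d i) = ?L c \<oplus>\<^bsub>M\<^esub> ?L d"
    if "\<And>i. c i \<in> carrier R" "\<And>i. d i \<in> carrier R" for c d
  proof -
    have "?L (\<lambda>i. c i \<oplus> d i) = (\<Oplus>\<^bsub>M\<^esub>i\<in>J. c i \<odot>\<^bsub>M\<^esub> v i \<oplus>\<^bsub>M\<^esub> d i \<odot>\<^bsub>M\<^esub> v i)"
      using v that by (intro M.finsum_cong') (auto simp: smult_l_distr)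
    also have "\<dots> = ?L c \<oplus>\<^bsub>M\<^esub> ?L d"
      using v that J(1) by (intro M.finsum_addf) auto
    finally show ?thesis .
  qed
  have L_smult: "?L (\<lambda>i. a \<otimes> c i) = a \<odot>\<^bsub>M\<^esub> ?L c"
    if "\<And>i. c i \<in> carrier R" "a \<in> carrier R" for c a
  proof -
    have "a \<odot>\<^bsub>M\<^esub> ?L c = (\<Oplus>\<^bsub>M\<^esub>i\<in>J. a \<odot>\<^bsub>M\<^esub> (c i \<odot>\<^bsub>M\<^esub> v i))"
      using v that J(1) by (intro finsum_smult_ldistr) auto
    also have "\<dots> = ?L (\<lambda>i. a \<otimes> c i)"
      using v that by (intro M.finsum_cong') (auto simp: smult_assoc1)
    finally show ?thesis ..
  qed
  have L_closed: "?L c \<in> carrier M" if "\<And>i. c i \<in> carrier R" for c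
    using v that by (intro M.finsum_closed) auto
  have unique: "c i = d i"
    if "\<And>i. c i \<in> carrier R" "\<And>i. d i \<in> carrier R" "?L c = ?L d" "i \<in> J" for c d i
  proof -
    \<comment> \<open>The difference is written with the scalar \<open>\<ominus> \<one>\<close>, so
      that additivity and homogeneity of \<open>?L\<close> already cover it.\<close>
    have "?L (\<lambda>i. c i \<oplus> (\<ominus> \<one>) \<otimes> d i) = ?L c \<oplus>\<^bsub>M\<^esub> (\<ominus> \<one>) \<odot>\<^bsub>M\<^esub> ?L d"
      using L_add[of c "\<lambda>i. (\<ominus> \<one>) \<otimes> d i"] L_smult[of d "\<ominus> \<one>"] that by simp
    also have "\<dots> = \<zero>\<^bsub>M\<^esub>"
      using that L_closed[of d] by (simp add: smult_l_minus M.r_neg)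
    finally have "c i \<oplus> (\<ominus> \<one>) \<otimes> d i = \<zero>"
      using J(3)[unfolded independent_family_def, rule_format, of "\<lambda>i. c i \<oplus> (\<ominus> \<one>) \<otimes> d i" i] that
      by auto
    then show ?thesis using that(1,2)
      by (simp add: R.l_minus R.minus_eq[symmetric] R.r_right_minus_eq)
  qed
  have closed: "x \<oplus>\<^bsub>M\<^esub> y \<in> span_family J v" "a \<odot>\<^bsub>M\<^esub> x \<in> span_family J v"
    if "x \<in> span_family J v" "y \<in> span_family J v" "a \<in> carrier R" for x y a
  proof -
    have "x \<oplus>\<^bsub>M\<^esub> y = ?L (\<lambda>i. \<gamma> x i \<oplus> \<gamma> y i)"
      using L_add[of "\<gamma> x" "\<gamma> y"] \<gamma> that by simp
    then show "x \<oplus>\<^bsub>M\<^esub> y \<in> span_family J v"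
      unfolding span_family_def using \<gamma>(1) by (intro CollectI exI conjI) auto
    have "a \<odot>\<^bsub>M\<^esub> x = ?L (\<lambda>i. a \<otimes> \<gamma> x i)"
      using L_smult[of "\<gamma> x" a] \<gamma> that by simp
    then show "a \<odot>\<^bsub>M\<^esub> x \<in> span_family J v"
      unfolding span_family_def using \<gamma>(1) that(3) by (intro CollectI exI conjI) auto
  qed
  show ?thesis
  proof (rule that[of "\<lambda>i x. \<gamma> x i"])
    fix i x y a
    assume i: "i \<in> J" and x: "x \<in> span_family J v"
    show "\<gamma> (x \<oplus>\<^bsub>M\<^esub> y) i = \<gamma> x i \<oplus> \<gamma> y i" if y: "y \<in> span_family J v"
      using L_add[of "\<gamma> x" "\<gamma> y"] \<gamma>(2)[OF x] \<gamma>(2)[OF y] \<gamma>(2)[OF closed(1)[OF x y R.zero_closed]] i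
      by (intro unique) (auto simp: \<gamma>(1))
    show "\<gamma> (a \<odot>\<^bsub>M\<^esub> x) i = a \<otimes> \<gamma> x i" if a: "a \<in> carrier R"
      using L_smult[of "\<gamma> x" a] \<gamma>(2)[OF x] \<gamma>(2)[OF closed(2)[OF x x a]] i a
      by (intro unique) (auto simp: \<gamma>(1))
  qed (use \<gamma> in auto)
qed

end

section \<open>Flatness of torsion-free modules\<close>

lemma tensor_kernel_subgroup:
  assumes "Module.module A M" "Module.module A N"
  shows "subgroup (tensor_kernel A M N) (free_Abelian_group (carrier M \<times> carrier N))"
  unfolding tensor_kernel_def
  using tensor_relators_subset[OF assms] by (intro group.generate_is_subgroup) auto

lemma tensor_kernel_closed:
  assumes "Module.module A M" "Module.module A N"
  shows "0 \<in> tensor_kernel A M N"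
    and "\<lbrakk>c \<in> tensor_kernel A M N; d \<in> tensor_kernel A M N\<rbrakk> \<Longrightarrow> c + d \<in> tensor_kernel A M N"
    and "c \<in> tensor_kernel A M N \<Longrightarrow> - c \<in> tensor_kernel A M N"
    and "\<lbrakk>c \<in> tensor_kernel A M N; d \<in> tensor_kernel A M N\<rbrakk> \<Longrightarrow> c - d \<in> tensor_kernel A M N"
proof -
  note K = tensor_kernel_subgroup[OF assms]
  show "0 \<in> tensor_kernel A M N"
    using subgroup.one_closed[OF K] by simp
  show add: "c + d \<in> tensor_kernel A M N"
    if "c \<in> tensor_kernel A M N" "d \<in> tensor_kernel A M N" for c d
    using subgroup.m_closed[OF K that] by simp
  show minus: "- c \<in> tensor_kernel A M N" if "c \<in> tensor_kernel A M N" for c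
    using subgroup.m_inv_closed[OF K that] subgroup.mem_carrier[OF K that] by simp
  show "c - d \<in> tensor_kernel A M N"
    if "c \<in> tensor_kernel A M N" "d \<in> tensor_kernel A M N"
    using add[OF that(1) minus[OF that(2)]] by simp
qed

lemma tensor_kernel_sum:
  assumes "Module.module A M" "Module.module A N" "\<And>i. i \<in> J \<Longrightarrow> c i \<in> tensor_kernel A M N"
  shows "(\<Sum>i\<in>J. c i) \<in> tensor_kernel A M N"
  using assms(3) tensor_kernel_closed(1,2)[OF assms(1,2)]
  by (induction J rule: infinite_finite_induct) auto

lemma tensor_kernel_relators:
  "\<lbrakk>x \<in> carrier M; x' \<in> carrier M; y \<in> carrier N\<rbrakk> \<Longrightarrow>
    frag_of (x \<oplus>\<^bsub>M\<^esub> x', y) - frag_of (x, y) - frag_of (x', y) \<in> tensor_kernel A M N"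
  "\<lbrakk>x \<in> carrier M; y \<in> carrier N; y' \<in> carrier N\<rbrakk> \<Longrightarrow>
    frag_of (x, y \<oplus>\<^bsub>N\<^esub> y') - frag_of (x, y) - frag_of (x, y') \<in> tensor_kernel A M N"
  "\<lbrakk>a \<in> carrier A; x \<in> carrier M; y \<in> carrier N\<rbrakk> \<Longrightarrow>
    frag_of (a \<odot>\<^bsub>M\<^esub> x, y) - frag_of (x, a \<odot>\<^bsub>N\<^esub> y) \<in> tensor_kernel A M N"
  unfolding tensor_kernel_def tensor_relators_def by (rule generate.incl; blast)+

text \<open>The additivity relator for zero plus zero collapses to minus the generator in
  question.\<close>

lemma tensor_kernel_zero:
  assumes "Module.module A M" "Module.module A N"
  shows "y \<in> carrier N \<Longrightarrow> frag_of (\<zero>\<^bsub>M\<^esub>, y) \<in> tensor_kernel A M N"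
    and "x \<in> carrier M \<Longrightarrow> frag_of (x, \<zero>\<^bsub>N\<^esub>) \<in> tensor_kernel A M N"
proof -
  interpret M: Module.module A M by fact
  interpret N: Module.module A N by fact
  note minus = tensor_kernel_closed(3)[OF assms]
  show "frag_of (\<zero>\<^bsub>M\<^esub>, y) \<in> tensor_kernel A M N" if "y \<in> carrier N"
    using minus[OF tensor_kernel_relators(1)[of "\<zero>\<^bsub>M\<^esub>" M "\<zero>\<^bsub>M\<^esub>" y N A]] that by simp
  show "frag_of (x, \<zero>\<^bsub>N\<^esub>) \<in> tensor_kernel A M N" if "x \<in> carrier M"
    using minus[OF tensor_kernel_relators(2)[of x M "\<zero>\<^bsub>N\<^esub>" N "\<zero>\<^bsub>N\<^esub>" A]] that by simp
qed

lemma tensor_kernel_finsum: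
  assumes "Module.module A M" "Module.module A N"
    and "finite J" "f \<in> J \<rightarrow> carrier M" "y \<in> carrier N"
  shows "frag_of (\<Oplus>\<^bsub>M\<^esub>i\<in>J. f i, y) - (\<Sum>i\<in>J. frag_of (f i, y)) \<in> tensor_kernel A M N"
  using assms(3,4)
proof (induction J rule: finite_induct)
  case empty
  interpret M: Module.module A M by fact
  show ?case using tensor_kernel_zero(1)[OF assms(1,2,5)] by simp
next
  case (insert j J)
  interpret M: Module.module A M by fact
  have f: "f j \<in> carrier M" "f \<in> J \<rightarrow> carrier M" "(\<Oplus>\<^bsub>M\<^esub>i\<in>J. f i) \<in> carrier M"
    using insert.prems by auto
  show ?case
    using tensor_kernel_closed(2)[OF assms(1,2) insert.IH[OF f(2)]
        tensor_kernel_relators(1)[OF f(1,3) assms(5), of A]] insert.hyps f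
    by (simp add: algebra_simps)
qed

text \<open>This is a negated additivity relator for \<open>y = (y - y') + y'\<close>. The form with
  a difference fits the induction on free abelian groups, whose compound step is
  subtraction.\<close>

lemma tensor_kernel_cong_right_diff:
  assumes "Module.module A M" "Module.module A N" "x \<in> carrier M" "y \<in> carrier N" "y' \<in> carrier N"
  shows "frag_of (x, y \<ominus>\<^bsub>N\<^esub> y') - frag_of (x, y) + frag_of (x, y') \<in> tensor_kernel A M N"
proof -
  interpret N: Module.module A N by fact
  have "y \<ominus>\<^bsub>N\<^esub> y' \<oplus>\<^bsub>N\<^esub> y' = y"
    using assms by (simp add: N.minus_eq N.a_assoc N.l_neg)
  then show ?thesis
    using tensor_kernel_closed(3)[OF assms(1,2)
        tensor_kernel_relators(2)[of x M "y \<ominus>\<^bsub>N\<^esub> y'" N y' A]] assms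
    by (simp add: algebra_simps)
qed

text \<open>Only finitely many relators, hence only finitely many elements of \<open>M\<close>, witness that
  an element vanishes in the tensor product; a functional \<open>\<beta>\<close> need only be linear on a set
  containing these.\<close>

lemma tensor_kernel_finite_support:
  fixes M :: "('a, 'b, 's) module_scheme" and N :: "('a, 'c, 't) module_scheme"
  assumes "Module.module A M" "Module.module A N" "c \<in> tensor_kernel A M N"
  obtains F where "finite F" "F \<subseteq> carrier M"
    "\<And>L \<beta> \<Phi>. \<lbrakk>F \<subseteq> L; \<beta> \<in> carrier M \<rightarrow> carrier A;
        \<And>x y. \<lbrakk>x \<in> L; y \<in> L\<rbrakk> \<Longrightarrow> \<beta> (x \<oplus>\<^bsub>M\<^esub> y) = \<beta> x \<oplus>\<^bsub>A\<^esub> \<beta> y;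
        \<And>a x. \<lbrakk>a \<in> carrier A; x \<in> L\<rbrakk> \<Longrightarrow> \<beta> (a \<odot>\<^bsub>M\<^esub> x) = a \<otimes>\<^bsub>A\<^esub> \<beta> x;
        \<Phi> \<in> hom (free_Abelian_group (carrier M \<times> carrier N)) (add_monoid N);
        \<And>x y. \<lbrakk>x \<in> carrier M; y \<in> carrier N\<rbrakk> \<Longrightarrow> \<Phi> (frag_of (x, y)) = \<beta> x \<odot>\<^bsub>N\<^esub> y\<rbrakk>
      \<Longrightarrow> \<Phi> c = \<zero>\<^bsub>N\<^esub>"
proof -
  interpret M: Module.module A M by fact
  interpret N: Module.module A N by fact
  let ?G = "free_Abelian_group (carrier M \<times> carrier N)"
  \<comment> \<open>Bundling the conditions lets the finite set be found before \<open>L\<close>,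
    \<open>\<beta>\<close> and \<open>\<Phi>\<close> are known; it depends on the relators
    alone.\<close>
  define good where "good L \<beta> \<Phi> \<longleftrightarrow> \<beta> \<in> carrier M \<rightarrow> carrier A \<and>
    (\<forall>x\<in>L. \<forall>y\<in>L. \<beta> (x \<oplus>\<^bsub>M\<^esub> y) = \<beta> x \<oplus>\<^bsub>A\<^esub> \<beta> y) \<and>
    (\<forall>a\<in>carrier A. \<forall>x\<in>L. \<beta> (a \<odot>\<^bsub>M\<^esub> x) = a \<otimes>\<^bsub>A\<^esub> \<beta> x) \<and>
    \<Phi> \<in> hom ?G (add_monoid N) \<and>
    (\<forall>x\<in>carrier M. \<forall>y\<in>carrier N. \<Phi> (frag_of (x, y)) = \<beta> x \<odot>\<^bsub>N\<^esub> y)" for L \<beta> \<Phi>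
  have hom: "group_hom ?G (add_monoid N) \<Phi>" if "good L \<beta> \<Phi>" for L \<beta> \<Phi>
    using that N.a_group unfolding good_def group_hom_def group_hom_axioms_def by auto
  have add: "\<Phi> (u + v) = \<Phi> u \<oplus>\<^bsub>N\<^esub> \<Phi> v"
    if "good L \<beta> \<Phi>" "u \<in> carrier ?G" "v \<in> carrier ?G" for L \<beta> \<Phi> u v
    using group_hom.hom_mult[OF hom[OF that(1)] that(2,3)] by simp
  have minus: "\<Phi> (- u) = \<ominus>\<^bsub>N\<^esub> \<Phi> u"
    if "good L \<beta> \<Phi>" "u \<in> carrier ?G" for L \<beta> \<Phi> u
    using group_hom.hom_inv[OF hom[OF that(1)] that(2)] that(2) by (simp add: a_inv_def)
  have closed: "\<Phi> u \<in> carrier N"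
    if "good L \<beta> \<Phi>" "u \<in> carrier ?G" for L \<beta> \<Phi> u
    using group_hom.hom_closed[OF hom[OF that(1)] that(2)] by simp
  have diff: "\<Phi> (u - v) = \<Phi> u \<ominus>\<^bsub>N\<^esub> \<Phi> v"
    if "good L \<beta> \<Phi>" "u \<in> carrier ?G" "v \<in> carrier ?G" for L \<beta> \<Phi> u v
    using add[OF that(1,2), of "- v"] minus[OF that(1,3)] that(3) by (simp add: N.minus_eq)
  have diff_closed: "u - v \<in> carrier ?G" if "u \<in> carrier ?G" "v \<in> carrier ?G" for u v
    using that keys_diff[of u v] by auto
  have rel: "\<exists>F. finite F \<and> F \<subseteq> carrier M \<and> (\<forall>L \<beta> \<Phi>. F \<subseteq> L \<longrightarrow> good L \<beta> \<Phi> \<longrightarrow> \<Phi> h = \<zero>\<^bsub>N\<^esub>)"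
    if "h \<in> tensor_relators A M N" for h
    using that unfolding tensor_relators_def
  proof (elim UnE CollectE exE conjE)
    fix x x' y
    assume h: "h = frag_of (x \<oplus>\<^bsub>M\<^esub> x', y) - frag_of (x, y) - frag_of (x', y)"
      and xy: "x \<in> carrier M" "x' \<in> carrier M" "y \<in> carrier N"
    have "\<Phi> h = \<zero>\<^bsub>N\<^esub>" if g: "good L \<beta> \<Phi>" and L: "{x, x'} \<subseteq> L" for L \<beta> \<Phi>
    proof -
      have "\<beta> x \<in> carrier A" "\<beta> x' \<in> carrier A" "\<beta> (x \<oplus>\<^bsub>M\<^esub> x') = \<beta> x \<oplus>\<^bsub>A\<^esub> \<beta> x'"
        "\<Phi> (frag_of (x, y)) = \<beta> x \<odot>\<^bsub>N\<^esub> y" "\<Phi> (frag_of (x', y)) = \<beta> x' \<odot>\<^bsub>N\<^esub> y"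
        "\<Phi> (frag_of (x \<oplus>\<^bsub>M\<^esub> x', y)) = \<beta> (x \<oplus>\<^bsub>M\<^esub> x') \<odot>\<^bsub>N\<^esub> y"
        using g xy L by (auto simp: good_def)
      then show ?thesis
        using xy unfolding h
        by (simp add: diff[OF g] diff_closed N.smult_l_distr N.minus_eq N.a_ac N.r_neg1 N.r_neg del: carrier_free_Abelian_group_iff)
    qed
    then show ?thesis using xy by (intro exI[of _ "{x, x'}"]) blast
  next
    fix x y y'
    assume h: "h = frag_of (x, y \<oplus>\<^bsub>N\<^esub> y') - frag_of (x, y) - frag_of (x, y')"
      and xy: "x \<in> carrier M" "y \<in> carrier N" "y' \<in> carrier N"
    \<comment> \<open>Additivity in the second argument involves a single value of
      \<open>\<beta>\<close>, so this relator contributes nothing to the finite set.\<close>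
    have "\<Phi> h = \<zero>\<^bsub>N\<^esub>" if g: "good L \<beta> \<Phi>" for L \<beta> \<Phi>
    proof -
      have "\<beta> x \<in> carrier A"
        "\<Phi> (frag_of (x, y)) = \<beta> x \<odot>\<^bsub>N\<^esub> y" "\<Phi> (frag_of (x, y')) = \<beta> x \<odot>\<^bsub>N\<^esub> y'"
        "\<Phi> (frag_of (x, y \<oplus>\<^bsub>N\<^esub> y')) = \<beta> x \<odot>\<^bsub>N\<^esub> (y \<oplus>\<^bsub>N\<^esub> y')"
        using g xy by (auto simp: good_def)
      then show ?thesis
        using xy unfolding h
        by (simp add: diff[OF g] diff_closed N.smult_r_distr N.minus_eq N.a_ac N.r_neg1 N.r_neg del: carrier_free_Abelian_group_iff)
    qed
    then show ?thesis by (intro exI[of _ "{}"]) blast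
  next
    fix a x y
    assume h: "h = frag_of (a \<odot>\<^bsub>M\<^esub> x, y) - frag_of (x, a \<odot>\<^bsub>N\<^esub> y)"
      and xy: "a \<in> carrier A" "x \<in> carrier M" "y \<in> carrier N"
    \<comment> \<open>Homogeneity of \<open>\<beta>\<close> at \<open>x\<close> and commutativity of
      \<open>A\<close> let the scalar pass to the other factor.\<close>
    have "\<Phi> h = \<zero>\<^bsub>N\<^esub>" if g: "good L \<beta> \<Phi>" and L: "{x} \<subseteq> L" for L \<beta> \<Phi>
    proof -
      have "\<beta> x \<in> carrier A" "\<beta> (a \<odot>\<^bsub>M\<^esub> x) = a \<otimes>\<^bsub>A\<^esub> \<beta> x"
        "\<Phi> (frag_of (a \<odot>\<^bsub>M\<^esub> x, y)) = \<beta> (a \<odot>\<^bsub>M\<^esub> x) \<odot>\<^bsub>N\<^esub> y"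
        "\<Phi> (frag_of (x, a \<odot>\<^bsub>N\<^esub> y)) = \<beta> x \<odot>\<^bsub>N\<^esub> (a \<odot>\<^bsub>N\<^esub> y)"
        using g xy L by (auto simp: good_def)
      then show ?thesis
        using xy unfolding h
        by (simp add: diff[OF g] M.m_comm[of a] N.smult_assoc1 N.minus_eq N.r_neg del: carrier_free_Abelian_group_iff)
    qed
    then show ?thesis using xy by (intro exI[of _ "{x}"]) blast
  qed
  have gen: "generate ?G (tensor_relators A M N) \<subseteq> carrier ?G"
    using tensor_relators_subset[OF assms(1,2)] by (intro group.generate_incl) auto
  have relc: "h \<in> carrier ?G" if "h \<in> tensor_relators A M N" for h
    using tensor_relators_subset[OF assms(1,2)] that by blast
  have "\<exists>F. finite F \<and> F \<subseteq> carrier M \<and> (\<forall>L \<beta> \<Phi>. F \<subseteq> L \<longrightarrow> good L \<beta> \<Phi> \<longrightarrow> \<Phi> c = \<zero>\<^bsub>N\<^esub>)"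
    using assms(3) unfolding tensor_kernel_def
  proof (induction c rule: generate.induct)
    case one
    have "\<Phi> \<one>\<^bsub>?G\<^esub> = \<zero>\<^bsub>N\<^esub>" if "good L \<beta> \<Phi>" for L \<beta> \<Phi>
      using group_hom.hom_one[OF hom[OF that]] by simp
    then show ?case by blast
  next
    case (incl h)
    then show ?case by (rule rel)
  next
    case (inv h)
    have "inv\<^bsub>?G\<^esub> h = - h" using relc[OF inv] by simp
    moreover have "\<Phi> (- h) = \<zero>\<^bsub>N\<^esub>" if "good L \<beta> \<Phi>" "\<Phi> h = \<zero>\<^bsub>N\<^esub>" for L \<beta> \<Phi>
      using minus[OF that(1) relc[OF inv]] that(2) by simp
    ultimately show ?case using rel[OF inv] by metis
  next
    case (eng h1 h2)
    obtain F1 where F1: "finite F1" "F1 \<subseteq> carrier M" "\<And>L \<beta> \<Phi>. F1 \<subseteq> L \<Longrightarrow> good L \<beta> \<Phi> \<Longrightarrow> \<Phi> h1 = \<zero>\<^bsub>N\<^esub>"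
      using eng.IH(1) by blast
    obtain F2 where F2: "finite F2" "F2 \<subseteq> carrier M" "\<And>L \<beta> \<Phi>. F2 \<subseteq> L \<Longrightarrow> good L \<beta> \<Phi> \<Longrightarrow> \<Phi> h2 = \<zero>\<^bsub>N\<^esub>"
      using eng.IH(2) by blast
    have h12: "h1 \<in> carrier ?G" "h2 \<in> carrier ?G" using eng.hyps gen by blast+
    have "\<Phi> (h1 \<otimes>\<^bsub>?G\<^esub> h2) = \<zero>\<^bsub>N\<^esub>" if "F1 \<union> F2 \<subseteq> L" "good L \<beta> \<Phi>" for L \<beta> \<Phi>
      using add[OF that(2) h12] F1(3)[of L \<beta> \<Phi>] F2(3)[of L \<beta> \<Phi>] that by simp
    then show ?case using F1 F2 by (intro exI[of _ "F1 \<union> F2"]) auto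
  qed
  then obtain F where F: "finite F" "F \<subseteq> carrier M"
    "\<And>L \<beta> \<Phi>. F \<subseteq> L \<Longrightarrow> good L \<beta> \<Phi> \<Longrightarrow> \<Phi> c = \<zero>\<^bsub>N\<^esub>"
    by blast
  show thesis
  proof (rule that[OF F(1,2)])
    fix L \<beta> \<Phi>
    assume "F \<subseteq> L" "\<beta> \<in> carrier M \<rightarrow> carrier A"
      "\<And>x y. \<lbrakk>x \<in> L; y \<in> L\<rbrakk> \<Longrightarrow> \<beta> (x \<oplus>\<^bsub>M\<^esub> y) = \<beta> x \<oplus>\<^bsub>A\<^esub> \<beta> y"
      "\<And>a x. \<lbrakk>a \<in> carrier A; x \<in> L\<rbrakk> \<Longrightarrow> \<beta> (a \<odot>\<^bsub>M\<^esub> x) = a \<otimes>\<^bsub>A\<^esub> \<beta> x"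
      "\<Phi> \<in> hom ?G (add_monoid N)"
      "\<And>x y. \<lbrakk>x \<in> carrier M; y \<in> carrier N\<rbrakk> \<Longrightarrow> \<Phi> (frag_of (x, y)) = \<beta> x \<odot>\<^bsub>N\<^esub> y"
    then show "\<Phi> c = \<zero>\<^bsub>N\<^esub>"
      by (intro F(3)[of L \<beta> \<Phi>]) (simp_all add: good_def)
  qed
qed

text \<open>Locally, a tensor is a sum of \<open>v i\<close> tensor \<open>\<Phi> i z\<close> over
  an independent family \<open>v\<close>. The coordinates commute with \<open>\<psi>\<close>, so if
  the image of \<open>z\<close> vanishes, then \<open>\<psi> (\<Phi> i z)\<close> is zero, and
  injectivity of \<open>\<psi>\<close> makes every coordinate zero.\<close>

theorem torsion_free_imp_flat:
  fixes M :: "('a, 'b, 's) module_scheme"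
  assumes euclid: "euclidean_domain A \<phi>"
    and M: "Module.module A M"
    and torsion_free: "\<And>a x. \<lbrakk>a \<in> carrier A; x \<in> carrier M; a \<odot>\<^bsub>M\<^esub> x = \<zero>\<^bsub>M\<^esub>\<rbrakk> \<Longrightarrow> a = \<zero>\<^bsub>A\<^esub> \<or> x = \<zero>\<^bsub>M\<^esub>"
  shows "flat_module A M TYPE('c) TYPE('d)"
  unfolding flat_module_def
proof (intro conjI allI impI M, elim conjE)
  fix N :: "('a, 'c) module" and N' :: "('a, 'd) module" and \<psi>
  assume N: "Module.module A N" and N': "Module.module A N'"
    and \<psi>: "\<psi> \<in> linear_maps A N N'" and inj: "inj_on \<psi> (carrier N)"
  interpret M: Module.module A M by fact
  interpret N: Module.module A N by fact
  interpret N': Module.module A N' by fact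
  let ?G = "free_Abelian_group (carrier M \<times> carrier N)"
  let ?G' = "free_Abelian_group (carrier M \<times> carrier N')"
  let ?K = "tensor_kernel A M N"
  let ?K' = "tensor_kernel A M N'"
  let ?g = "frag_extend (\<lambda>(x, y). frag_of (x, \<psi> y))"
  have \<psi>_closed: "\<psi> y \<in> carrier N'" if "y \<in> carrier N" for y
    using \<psi> that by (auto simp: linear_maps_def)
  have \<psi>_add: "\<psi> (x \<oplus>\<^bsub>N\<^esub> y) = \<psi> x \<oplus>\<^bsub>N'\<^esub> \<psi> y" if "x \<in> carrier N" "y \<in> carrier N" for x y
    using \<psi> that by (auto simp: linear_maps_def)
  have \<psi>_smult: "\<psi> (a \<odot>\<^bsub>N\<^esub> x) = a \<odot>\<^bsub>N'\<^esub> \<psi> x" if "a \<in> carrier A" "x \<in> carrier N" for a x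
    using \<psi> that by (auto simp: linear_maps_def)
  have \<psi>_hom: "group_hom (add_monoid N) (add_monoid N') \<psi>"
    using \<psi>_closed \<psi>_add N.a_group N'.a_group
    unfolding group_hom_def group_hom_axioms_def by (auto intro: homI)
  have \<psi>_zero: "\<psi> \<zero>\<^bsub>N\<^esub> = \<zero>\<^bsub>N'\<^esub>"
    using group_hom.hom_one[OF \<psi>_hom] by simp
  have \<psi>_minus: "\<psi> (x \<ominus>\<^bsub>N\<^esub> y) = \<psi> x \<ominus>\<^bsub>N'\<^esub> \<psi> y" if "x \<in> carrier N" "y \<in> carrier N" for x y
  proof -
    have "\<psi> (\<ominus>\<^bsub>N\<^esub> y) = \<ominus>\<^bsub>N'\<^esub> \<psi> y"
      using group_hom.hom_inv[OF \<psi>_hom, of y] that unfolding a_inv_def by simp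
    then show ?thesis using that by (simp add: N.minus_eq N'.minus_eq \<psi>_add)
  qed
  have key: "z \<in> ?K" if z: "z \<in> carrier ?G" and gz: "?g z \<in> ?K'" for z
  proof -
    obtain F0 where F0: "finite F0" "F0 \<subseteq> carrier M" and
      vanish: "\<And>L \<beta> \<Phi>. \<lbrakk>F0 \<subseteq> L; \<beta> \<in> carrier M \<rightarrow> carrier A;
        \<And>x y. \<lbrakk>x \<in> L; y \<in> L\<rbrakk> \<Longrightarrow> \<beta> (x \<oplus>\<^bsub>M\<^esub> y) = \<beta> x \<oplus>\<^bsub>A\<^esub> \<beta> y;
        \<And>a x. \<lbrakk>a \<in> carrier A; x \<in> L\<rbrakk> \<Longrightarrow> \<beta> (a \<odot>\<^bsub>M\<^esub> x) = a \<otimes>\<^bsub>A\<^esub> \<beta> x;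
        \<Phi> \<in> hom ?G' (add_monoid N');
        \<And>x y. \<lbrakk>x \<in> carrier M; y \<in> carrier N'\<rbrakk> \<Longrightarrow> \<Phi> (frag_of (x, y)) = \<beta> x \<odot>\<^bsub>N'\<^esub> y\<rbrakk>
      \<Longrightarrow> \<Phi> (?g z) = \<zero>\<^bsub>N'\<^esub>"
      by (rule tensor_kernel_finite_support[OF M N' gz]) blast
    \<comment> \<open>\<open>F0\<close> makes the coordinates vanish on the certificate for
      \<open>?g z\<close>; the first components of \<open>z\<close> are added so that
      \<open>z\<close> itself can be expanded.\<close>
    define F where "F = F0 \<union> fst ` Poly_Mapping.keys z"
    have F: "finite F" "F \<subseteq> carrier M" using F0 z by (auto simp: F_def)
    obtain J :: "'b set" and v where J: "finite J" and v: "v \<in> J \<rightarrow> carrier M"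
      and span: "F \<subseteq> M.span_family J v" and indep: "M.independent_family J v"
      using M.finite_subset_span_independent[OF euclid torsion_free F] by blast
    obtain \<beta> where \<beta>: "\<And>i x. \<beta> i x \<in> carrier A"
      and \<beta>_sum: "\<And>x. x \<in> M.span_family J v \<Longrightarrow> x = (\<Oplus>\<^bsub>M\<^esub>i\<in>J. \<beta> i x \<odot>\<^bsub>M\<^esub> v i)"
      and \<beta>_add: "\<And>i x y. \<lbrakk>i \<in> J; x \<in> M.span_family J v; y \<in> M.span_family J v\<rbrakk>
        \<Longrightarrow> \<beta> i (x \<oplus>\<^bsub>M\<^esub> y) = \<beta> i x \<oplus>\<^bsub>A\<^esub> \<beta> i y"
      and \<beta>_smult: "\<And>i a x. \<lbrakk>i \<in> J; a \<in> carrier A; x \<in> M.span_family J v\<rbrakk>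
        \<Longrightarrow> \<beta> i (a \<odot>\<^bsub>M\<^esub> x) = a \<otimes>\<^bsub>A\<^esub> \<beta> i x"
      by (rule M.independent_family_coordinates[OF J v indep]) blast
    \<comment> \<open>The universal property of the free abelian group accepts any function on
      pairs, so the lack of linearity of \<open>\<beta> i\<close> off the span does no harm.\<close>
    have "\<exists>\<Phi>. \<Phi> \<in> hom ?G (add_monoid N) \<and>
        (\<forall>x\<in>carrier M. \<forall>y\<in>carrier N. \<Phi> (frag_of (x, y)) = \<beta> i x \<odot>\<^bsub>N\<^esub> y)" for i
    proof -
      have "(\<lambda>(x, y). \<beta> i x \<odot>\<^bsub>N\<^esub> y) ` (carrier M \<times> carrier N) \<subseteq> carrier (add_monoid N)"
        using \<beta> by auto
      then obtain h where "h \<in> hom ?G (add_monoid N)"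
        "\<And>p. p \<in> carrier M \<times> carrier N \<Longrightarrow> h (frag_of p) = (\<lambda>(x, y). \<beta> i x \<odot>\<^bsub>N\<^esub> y) p"
        by (rule comm_group.free_Abelian_group_universal[OF N.a_comm_group]) blast
      then show ?thesis by (intro exI[of _ h]) auto
    qed
    then obtain \<Phi> where \<Phi>: "\<And>i. \<Phi> i \<in> hom ?G (add_monoid N)"
      "\<And>i x y. \<lbrakk>x \<in> carrier M; y \<in> carrier N\<rbrakk> \<Longrightarrow> \<Phi> i (frag_of (x, y)) = \<beta> i x \<odot>\<^bsub>N\<^esub> y"
      by metis
    have "\<exists>\<Phi>. \<Phi> \<in> hom ?G' (add_monoid N') \<and>
        (\<forall>x\<in>carrier M. \<forall>y\<in>carrier N'. \<Phi> (frag_of (x, y)) = \<beta> i x \<odot>\<^bsub>N'\<^esub> y)" for i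
    proof -
      have "(\<lambda>(x, y). \<beta> i x \<odot>\<^bsub>N'\<^esub> y) ` (carrier M \<times> carrier N') \<subseteq> carrier (add_monoid N')"
        using \<beta> by auto
      then obtain h where "h \<in> hom ?G' (add_monoid N')"
        "\<And>p. p \<in> carrier M \<times> carrier N' \<Longrightarrow> h (frag_of p) = (\<lambda>(x, y). \<beta> i x \<odot>\<^bsub>N'\<^esub> y) p"
        by (rule comm_group.free_Abelian_group_universal[OF N'.a_comm_group]) blast
      then show ?thesis by (intro exI[of _ h]) auto
    qed
    then obtain \<Phi>' where \<Phi>': "\<And>i. \<Phi>' i \<in> hom ?G' (add_monoid N')"
      "\<And>i x y. \<lbrakk>x \<in> carrier M; y \<in> carrier N'\<rbrakk> \<Longrightarrow> \<Phi>' i (frag_of (x, y)) = \<beta> i x \<odot>\<^bsub>N'\<^esub> y"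
      by metis
    have h: "group_hom ?G (add_monoid N) (\<Phi> i)" and h': "group_hom ?G' (add_monoid N') (\<Phi>' i)" for i
      using \<Phi>(1) \<Phi>'(1) N.a_group N'.a_group by (auto simp: group_hom_def group_hom_axioms_def)
    have \<Phi>_closed: "\<Phi> i c \<in> carrier N" if "c \<in> carrier ?G" for i c
      using group_hom.hom_closed[OF h that] by simp
    have \<Phi>_diff: "\<Phi> i (c - d) = \<Phi> i c \<ominus>\<^bsub>N\<^esub> \<Phi> i d" if "c \<in> carrier ?G" "d \<in> carrier ?G" for i c d
      using group_hom.hom_mult[OF h that(1), of "- d"] group_hom.hom_inv[OF h that(2)] that
      by (simp add: N.minus_eq a_inv_def)
    have \<Phi>'_diff: "\<Phi>' i (c - d) = \<Phi>' i c \<ominus>\<^bsub>N'\<^esub> \<Phi>' i d" if "c \<in> carrier ?G'" "d \<in> carrier ?G'" for i c d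
      using group_hom.hom_mult[OF h' that(1), of "- d"] group_hom.hom_inv[OF h' that(2)] that
      by (simp add: N'.minus_eq a_inv_def)
    have \<Phi>_zero: "\<Phi> i 0 = \<zero>\<^bsub>N\<^esub>" and \<Phi>'_zero: "\<Phi>' i 0 = \<zero>\<^bsub>N'\<^esub>" for i
      using group_hom.hom_one[OF h] group_hom.hom_one[OF h'] by simp_all
    \<comment> \<open>Naturality of the coordinates needs only linearity of \<open>\<psi>\<close>.
      Membership in the carrier is carried along because the subtraction step applies
      \<open>\<Phi>'_diff\<close> to the images.\<close>
    have "?g c \<in> carrier ?G' \<and> \<psi> (\<Phi> i c) = \<Phi>' i (?g c)" if "Poly_Mapping.keys c \<subseteq> carrier M \<times> carrier N" for i c
      using that
    proof (induction c rule: free_Abelian_group_induct[consumes 1])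
      case 1
      then show ?case using \<psi>_zero by (simp add: \<Phi>_zero \<Phi>'_zero)
    next
      case (2 c d)
      have "?g c - ?g d \<in> carrier ?G'" using 2 keys_diff[of "?g c" "?g d"] by auto
      moreover have "\<psi> (\<Phi> i (c - d)) = \<Phi>' i (?g c - ?g d)"
        using 2 \<Phi>_diff[of c d i] \<Phi>'_diff[of "?g c" "?g d" i] \<psi>_minus \<Phi>_closed[of c i] \<Phi>_closed[of d i]
        by simp
      ultimately show ?case by (simp add: frag_extend_diff)
    next
      case (3 p)
      then show ?case
        using \<psi>_closed \<psi>_smult \<beta> by (cases p) (simp add: \<Phi> \<Phi>')
    qed
    then have \<psi>\<Phi>: "\<psi> (\<Phi> i z) = \<Phi>' i (?g z)" for i using z by simp
    have \<Phi>z: "\<Phi> i z = \<zero>\<^bsub>N\<^esub>" if "i \<in> J" for i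
    proof -
      have "\<Phi>' i (?g z) = \<zero>\<^bsub>N'\<^esub>"
        using vanish[of "M.span_family J v" "\<beta> i" "\<Phi>' i"] span \<beta> \<beta>_add \<beta>_smult \<Phi>' that
        by (simp add: F_def)
      then show ?thesis
        using inj_onD[OF inj, of "\<Phi> i z" "\<zero>\<^bsub>N\<^esub>"] \<psi>\<Phi>[of i] \<psi>_zero \<Phi>_closed[OF z, of i] by simp
    qed
    have vJ: "v i \<in> carrier M" if "i \<in> J" for i using v that by auto
    note Kc = tensor_kernel_closed[OF M N] and Ks = tensor_kernel_sum[OF M N, of J]
    \<comment> \<open>First components are confined to \<open>F\<close>, since only there does
      \<open>\<beta>_sum\<close> expand them in the family \<open>v\<close>; on a generator the
      coefficients are then moved across to the second factor.\<close>
    have "c - (\<Sum>i\<in>J. frag_of (v i, \<Phi> i c)) \<in> ?K" if "Poly_Mapping.keys c \<subseteq> F \<times> carrier N" for c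
      using that
    proof (induction c rule: free_Abelian_group_induct[consumes 1])
      case 1
      have "(\<Sum>i\<in>J. frag_of (v i, \<zero>\<^bsub>N\<^esub>)) \<in> ?K"
        using vJ tensor_kernel_zero(2)[OF M N] by (intro Ks) auto
      then show ?case using Kc(3) by (simp add: \<Phi>_zero)
    next
      case (2 c d)
      have cd: "c \<in> carrier ?G" "d \<in> carrier ?G" using 2 F by auto
      have "(\<Sum>i\<in>J. frag_of (v i, \<Phi> i c \<ominus>\<^bsub>N\<^esub> \<Phi> i d) - frag_of (v i, \<Phi> i c) + frag_of (v i, \<Phi> i d)) \<in> ?K"
        using vJ \<Phi>_closed cd by (intro Ks tensor_kernel_cong_right_diff[OF M N]) auto
      from Kc(4)[OF Kc(4)[OF 2(3,4)] this] show ?case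
        by (simp add: \<Phi>_diff[OF cd] sum.distrib sum_subtractf algebra_simps)
    next
      case (3 p)
      obtain x y where p: "p = (x, y)" by (cases p)
      have xy: "x \<in> F" "y \<in> carrier N" "x \<in> carrier M" using 3 F p by auto
      have "frag_of (\<Oplus>\<^bsub>M\<^esub>i\<in>J. \<beta> i x \<odot>\<^bsub>M\<^esub> v i, y) - (\<Sum>i\<in>J. frag_of (\<beta> i x \<odot>\<^bsub>M\<^esub> v i, y)) \<in> ?K"
        using J xy vJ \<beta> by (intro tensor_kernel_finsum[OF M N]) auto
      then have "frag_of (x, y) - (\<Sum>i\<in>J. frag_of (\<beta> i x \<odot>\<^bsub>M\<^esub> v i, y)) \<in> ?K"
        using \<beta>_sum[of x] xy(1) span by auto
      moreover have "(\<Sum>i\<in>J. frag_of (\<beta> i x \<odot>\<^bsub>M\<^esub> v i, y) - frag_of (v i, \<beta> i x \<odot>\<^bsub>N\<^esub> y)) \<in> ?K"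
        using xy vJ \<beta> by (intro Ks tensor_kernel_relators(3)) auto
      ultimately show ?case
        using Kc(2) xy by (fastforce simp: p \<Phi> sum_subtractf)
    qed
    moreover have "Poly_Mapping.keys z \<subseteq> F \<times> carrier N"
      using z by (force simp: F_def)
    ultimately have "z - (\<Sum>i\<in>J. frag_of (v i, \<Phi> i z)) \<in> ?K" by blast
    moreover have "(\<Sum>i\<in>J. frag_of (v i, \<Phi> i z)) \<in> ?K"
      using \<Phi>z vJ tensor_kernel_zero(2)[OF M N] by (intro Ks) auto
    ultimately show ?thesis using Kc(2) by fastforce
  qed
  show "inj_on (tensor_map A M N' \<psi>) (carrier (tensor_group A M N))"
  proof (rule inj_onI)
    fix C D
    assume "C \<in> carrier (tensor_group A M N)" "D \<in> carrier (tensor_group A M N)"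
    then obtain c d where cd: "c \<in> carrier ?G" "d \<in> carrier ?G"
      and C: "C = ?K #>\<^bsub>?G\<^esub> c" and D: "D = ?K #>\<^bsub>?G\<^esub> d"
      by (auto simp: tensor_group_def FactGroup_def RCOSETS_def simp del: carrier_free_Abelian_group_iff)
    assume "tensor_map A M N' \<psi> C = tensor_map A M N' \<psi> D"
    then have "?K' #>\<^bsub>?G'\<^esub> ?g c = ?K' #>\<^bsub>?G'\<^esub> ?g d"
      unfolding C D using tensor_map_coset[OF M N N' \<psi>] cd by simp
    moreover have "?g c \<in> ?K' #>\<^bsub>?G'\<^esub> ?g c"
      using tensor_kernel_closed(1)[OF M N'] by (force simp: r_coset_def)
    ultimately obtain k where "k \<in> ?K'" "?g c = k + ?g d"
      by (auto simp: r_coset_def)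
    then have "?g (c - d) \<in> ?K'" by (simp add: frag_extend_diff)
    moreover have "c - d \<in> carrier ?G" using cd keys_diff[of c d] by auto
    ultimately have "c - d \<in> ?K" by (intro key)
    then have "c \<in> ?K #>\<^bsub>?G\<^esub> d"
      by (auto simp: r_coset_def intro!: bexI[of _ "c - d"])
    then show "C = D"
      unfolding C D using group.repr_independence[OF group_free_Abelian_group _ cd(2) tensor_kernel_subgroup[OF M N]]
      by simp
  qed
qed

section \<open>Homogenization\<close>

lemma ring_of_type_algebra_simps [simp]:
  "carrier (ring_of_type_algebra :: 'a::ring_1 ring) = UNIV"
  "x \<otimes>\<^bsub>ring_of_type_algebra\<^esub> y = x * y"
  "\<one>\<^bsub>ring_of_type_algebra\<^esub> = 1"
  "\<zero>\<^bsub>ring_of_type_algebra\<^esub> = 0"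
  "x \<oplus>\<^bsub>ring_of_type_algebra\<^esub> y = x + y"
  by (simp_all add: ring_of_type_algebra_def)

lemma ring_of_type_algebra_a_inv [simp]:
  "\<ominus>\<^bsub>ring_of_type_algebra\<^esub> x = - (x :: 'a::comm_ring_1)"
proof -
  interpret ring "ring_of_type_algebra :: 'a ring" by rule
  show ?thesis by (rule minus_equality) auto
qed

lemma ideal_ring_of_type_algebraD:
  fixes I :: "'a::comm_ring_1 set"
  assumes "ideal I ring_of_type_algebra"
  shows "0 \<in> I" "\<lbrakk>x \<in> I; y \<in> I\<rbrakk> \<Longrightarrow> x + y \<in> I" "x \<in> I \<Longrightarrow> r * x \<in> I"
    "\<lbrakk>x \<in> I; y \<in> I\<rbrakk> \<Longrightarrow> x - y \<in> I" "(\<And>i. i \<in> A \<Longrightarrow> f i \<in> I) \<Longrightarrow> sum f A \<in> I"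
proof -
  interpret ideal I "ring_of_type_algebra :: 'a ring" by fact
  show zero: "0 \<in> I" using additive_subgroup.zero_closed[OF is_additive_subgroup] by simp
  show add: "x + y \<in> I" if "x \<in> I" "y \<in> I" for x y using additive_subgroup.a_closed[OF is_additive_subgroup that] by simp
  show mult: "r * x \<in> I" if "x \<in> I" for r x using I_l_closed[OF that, of r] by simp
  show "x - y \<in> I" if "x \<in> I" "y \<in> I" using add[OF that(1) mult[OF that(2), of "- 1"]] by simp
  show "sum f A \<in> I" if "\<And>i. i \<in> A \<Longrightarrow> f i \<in> I"
    using that by (induction A rule: infinite_finite_induct) (auto intro: zero add)
qed

lemma ideal_ring_of_type_algebraI:
  fixes I :: "'a::comm_ring_1 set"
  assumes "0 \<in> I" "\<And>x y. \<lbrakk>x \<in> I; y \<in> I\<rbrakk> \<Longrightarrow> x + y \<in> I" "\<And>r x. x \<in> I \<Longrightarrow> r * x \<in> I"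
  shows "ideal I ring_of_type_algebra"
proof -
  interpret ring "ring_of_type_algebra :: 'a ring" by rule
  have minus: "- x \<in> I" if "x \<in> I" for x using assms(3)[OF that, of "- 1"] by simp
  have "subgroup I (add_monoid ring_of_type_algebra)"
  proof
    show "inv\<^bsub>add_monoid ring_of_type_algebra\<^esub> x \<in> I" if "x \<in> I" for x
      using minus[OF that] ring_of_type_algebra_a_inv[of x] unfolding a_inv_def by simp
  qed (use assms in auto)
  then show ?thesis
    by (rule idealI[OF ring_axioms]) (use assms(3) in \<open>simp_all add: mult.commute[of _ "_ :: 'a"]\<close>)
qed

lemma euclidean_domain_poly:
  "euclidean_domain (ring_of_type_algebra :: 'k::field poly ring) degree"
proof -
  interpret cring "ring_of_type_algebra :: 'k poly ring" by rule
  interpret domain "ring_of_type_algebra :: 'k poly ring"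
    by unfold_locales auto
  show ?thesis
  proof (rule euclidean_domainI)
    fix a b :: "'k poly"
    assume "b \<in> carrier ring_of_type_algebra - {\<zero>\<^bsub>ring_of_type_algebra\<^esub>}"
    then show "\<exists>q r. q \<in> carrier ring_of_type_algebra \<and> r \<in> carrier ring_of_type_algebra \<and>
      a = b \<otimes>\<^bsub>ring_of_type_algebra\<^esub> q \<oplus>\<^bsub>ring_of_type_algebra\<^esub> r \<and>
      (r = \<zero>\<^bsub>ring_of_type_algebra\<^esub> \<or> degree r < degree b)"
      using degree_mod_less[of b a] by (intro exI[of _ "a div b"] exI[of _ "a mod b"]) auto
  qed
qed

section \<open>Monomials and weight components\<close>

lemma poly_mapping_sum_single:
  "(\<Sum>a\<in>Poly_Mapping.keys f. Poly_Mapping.single a (Poly_Mapping.lookup f a)) = f"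
  by (rule poly_mapping_eqI)
    (simp add: lookup_sum lookup_single when_def in_keys_iff)

text \<open>Every element of \<open>k[X][t]\<close> is a finite sum of terms
  \<open>c x^a t^j\<close>, so statements compatible with addition need checking only on terms of a
  single weight.\<close>

lemma mpoly_poly_induct [case_names zero add monom]:
  fixes g :: "('n, 'k::comm_ring_1) mpoly poly"
  assumes "P 0" "\<And>g h. \<lbrakk>P g; P h\<rbrakk> \<Longrightarrow> P (g + h)"
    and "\<And>a c j. P (Polynomial.monom (Poly_Mapping.single a c) j)"
  shows "P g"
proof -
  have sum: "P (sum f A)" if "\<And>x. x \<in> A \<Longrightarrow> P (f x)" for f and A :: "'x set"
    using that by (induction A rule: infinite_finite_induct) (auto intro: assms)
  have "P (Polynomial.monom f j)" for f :: "('n, 'k) mpoly" and j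
  proof -
    have "Polynomial.monom f j = (\<Sum>a\<in>Poly_Mapping.keys f.
        Polynomial.monom (Poly_Mapping.single a (Poly_Mapping.lookup f a)) j)"
      by (simp only: monom_sum[symmetric] poly_mapping_sum_single)
    then show ?thesis by (simp only:) (intro sum assms(3))
  qed
  then show ?thesis
    using sum[of "{..degree g}" "\<lambda>i. Polynomial.monom (coeff g i) i"] poly_as_sum_of_monoms[of g] by simp
qed

text \<open>Giving \<open>t\<close> weight 1, this is the component of weight \<open>d\<close> of a polynomial in \<open>k[X,t]\<close>,
  evaluated at \<open>t = 1\<close>.\<close>

definition weight_component :: "('n::finite \<Rightarrow> int) \<Rightarrow> int \<Rightarrow> ('n, 'k::comm_ring_1) mpoly poly \<Rightarrow> ('n, 'k) mpoly"
  where "weight_component w d g = Poly_Mapping.Abs_poly_mapping (\<lambda>a.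
    if weight w a \<le> d then Poly_Mapping.lookup (coeff g (nat (d - weight w a))) a else 0)"

text \<open>The support is finite because it lies among the exponents of the finitely many
  coefficients of \<open>g\<close>. The guard on the weight matters: \<open>nat\<close> would send a
  negative exponent of \<open>t\<close> to 0 and pick up a foreign coefficient.\<close>

lemma lookup_weight_component:
  "Poly_Mapping.lookup (weight_component w d g) a =
    (if weight w a \<le> d then Poly_Mapping.lookup (coeff g (nat (d - weight w a))) a else 0)"
proof -
  have "a \<in> (\<Union>j\<le>degree g. Poly_Mapping.keys (coeff g j))"
    if "Poly_Mapping.lookup (coeff g j) a \<noteq> 0" for a j
  proof -
    have "j \<le> degree g" using that by (intro le_degree) auto
    then show ?thesis using that by (auto simp: in_keys_iff)
  qed
  then have "{a. (if weight w a \<le> d then Poly_Mapping.lookup (coeff g (nat (d - weight w a))) a else 0) \<noteq> 0}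
      \<subseteq> (\<Union>j\<le>degree g. Poly_Mapping.keys (coeff g j))"
    by (auto split: if_splits)
  then have "finite {a. (if weight w a \<le> d then Poly_Mapping.lookup (coeff g (nat (d - weight w a))) a else 0) \<noteq> 0}"
    by (rule finite_subset) auto
  then show ?thesis
    unfolding weight_component_def by (subst lookup_Abs_poly_mapping) auto
qed

lemma weight_component_0 [simp]: "weight_component w d 0 = 0"
  by (rule poly_mapping_eqI) (simp add: lookup_weight_component)

lemma weight_component_add:
  "weight_component w d (g + h) = weight_component w d g + weight_component w d h"
  by (rule poly_mapping_eqI) (simp add: lookup_weight_component lookup_add)

lemma weight_component_sum:
  "weight_component w d (\<Sum>i\<in>A. f i) = (\<Sum>i\<in>A. weight_component w d (f i))"
  by (induction A rule: infinite_finite_induct) (auto simp: weight_component_add)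

lemma weight_component_monom:
  "weight_component w d (Polynomial.monom (Poly_Mapping.single a c) j) =
    (if weight w a + int j = d then Poly_Mapping.single a c else 0)"
  by (rule poly_mapping_eqI) (auto simp: lookup_weight_component lookup_single when_def)

lemma weight_add: "weight w (a + b) = weight w a + weight w b"
  by (simp add: weight_def lookup_add algebra_simps sum.distrib)

lemma weight_component_monom_mult:
  "weight_component w d (Polynomial.monom (Poly_Mapping.single b c) j * g) =
    Poly_Mapping.single b c * weight_component w (d - weight w b - int j) g"
proof (induction g rule: mpoly_poly_induct)
  case (monom a e i)
  show ?case by (auto simp: mult_monom mult_single weight_component_monom weight_add)
qed (simp_all add: distrib_left weight_component_add)

text \<open>A single term meets just one weight. Finiteness supplies both the finite decomposition
  of \<open>g\<close> and a least weight with a prescribed property, for weights of either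
  sign.\<close>

lemma finite_weight_component: "finite {d. weight_component w d g \<noteq> 0}"
proof (induction g rule: mpoly_poly_induct)
  case (add g h)
  have "{d. weight_component w d (g + h) \<noteq> 0} \<subseteq>
      {d. weight_component w d g \<noteq> 0} \<union> {d. weight_component w d h \<noteq> 0}"
    by (auto simp: weight_component_add)
  then show ?case using add by (meson finite_UnI finite_subset)
next
  case (monom a c j)
  have "{d. weight_component w d (Polynomial.monom (Poly_Mapping.single a c) j) \<noteq> 0} \<subseteq> {weight w a + int j}"
    by (auto simp: weight_component_monom)
  then show ?case by (rule finite_subset) simp
qed simp

text \<open>The power of \<open>t\<close> at \<open>x^a\<close> tops its weight up to
  \<open>wdeg w f\<close>, so all terms share that weight. For \<open>f = 0\<close> both sides
  vanish, whatever value \<open>wdeg\<close> takes there.\<close>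

lemma weight_component_homogenize:
  fixes f :: "('n::finite, 'k::comm_ring_1) mpoly"
  shows "weight_component w d (homogenize w f) = (if d = wdeg w f then f else 0)"
proof -
  have le: "weight w a \<le> wdeg w f" if "a \<in> Poly_Mapping.keys f" for a
    using that by (simp add: wdeg_def)
  have "weight_component w d (homogenize w f) =
      (\<Sum>a\<in>Poly_Mapping.keys f. if d = wdeg w f then Poly_Mapping.single a (Poly_Mapping.lookup f a) else 0)"
    unfolding homogenize_def weight_component_sum weight_component_monom
    by (intro sum.cong refl) (use le in auto)
  then show ?thesis by (simp add: poly_mapping_sum_single)
qed

text \<open>Both truncated differences are genuine, so the exponents of \<open>t\<close> add up to
  \<open>d - w . a\<close>: homogenization to a prescribed weight \<open>d\<close> at least the
  degree.\<close>

lemma monom_mult_homogenize: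
  fixes f :: "('n::finite, 'k::comm_ring_1) mpoly"
  assumes "wdeg w f \<le> d"
  shows "Polynomial.monom 1 (nat (d - wdeg w f)) * homogenize w f =
    (\<Sum>a\<in>Poly_Mapping.keys f. Polynomial.monom (Poly_Mapping.single a (Poly_Mapping.lookup f a)) (nat (d - weight w a)))"
proof -
  have le: "weight w a \<le> wdeg w f" if "a \<in> Poly_Mapping.keys f" for a
    using that by (simp add: wdeg_def)
  have "nat (d - wdeg w f) + nat (wdeg w f - weight w a) = nat (d - weight w a)"
    if "a \<in> Poly_Mapping.keys f" for a using le[OF that] assms by simp
  then show ?thesis
    unfolding homogenize_def sum_distrib_left by (intro sum.cong refl) (simp add: mult_monom)
qed

lemma wdeg_weight_component_le:
  assumes "weight_component w d g \<noteq> 0"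
  shows "wdeg w (weight_component w d g) \<le> d"
  unfolding wdeg_def using assms
  by (subst Max_le_iff) (auto simp: in_keys_iff lookup_weight_component split: if_splits)

text \<open>Putting \<open>t\<close> back into each component recovers \<open>g\<close>. The extra
  power of \<open>t\<close> is needed since the degree of a component can be less than
  \<open>d\<close>, namely when \<open>t\<close> divides the whole weight-\<open>d\<close> part of
  \<open>g\<close>.\<close>

lemma sum_weight_component:
  fixes g :: "('n::finite, 'k::comm_ring_1) mpoly poly"
  shows "(\<Sum>d | weight_component w d g \<noteq> 0.
    Polynomial.monom 1 (nat (d - wdeg w (weight_component w d g))) * homogenize w (weight_component w d g)) = g"
    (is "?S = g")
proof (rule poly_eqI, rule poly_mapping_eqI)
  fix j a
  let ?h = "\<lambda>d. weight_component w d g"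
  have summand: "Poly_Mapping.lookup (coeff (\<Sum>a\<in>Poly_Mapping.keys (?h d). Polynomial.monom
      (Poly_Mapping.single a (Poly_Mapping.lookup (?h d) a)) (nat (d - weight w a))) j) a =
      (if d = weight w a + int j then Poly_Mapping.lookup (?h d) a else 0)" for d
  proof -
    have "Poly_Mapping.lookup (coeff (\<Sum>a\<in>Poly_Mapping.keys (?h d). Polynomial.monom
        (Poly_Mapping.single a (Poly_Mapping.lookup (?h d) a)) (nat (d - weight w a))) j) a =
      (\<Sum>b\<in>Poly_Mapping.keys (?h d). if a = b then (if nat (d - weight w a) = j then Poly_Mapping.lookup (?h d) a else 0) else 0)"
      unfolding coeff_sum lookup_sum
      by (intro sum.cong refl) (auto simp: lookup_single when_def)
    also have "\<dots> = (if a \<in> Poly_Mapping.keys (?h d) \<and> nat (d - weight w a) = j then Poly_Mapping.lookup (?h d) a else 0)"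
      by simp
    \<comment> \<open>Membership of \<open>a\<close> in the support gives
      \<open>weight w a \<le> d\<close>, which excludes the spurious solutions of
      \<open>nat (d - weight w a) = j\<close> at \<open>j = 0\<close>.\<close>
    also have "\<dots> = (if d = weight w a + int j then Poly_Mapping.lookup (?h d) a else 0)"
      by (auto simp: in_keys_iff lookup_weight_component split: if_splits)
    finally show ?thesis .
  qed
  have "Poly_Mapping.lookup (coeff ?S j) a =
    (\<Sum>d | ?h d \<noteq> 0. if d = weight w a + int j then Poly_Mapping.lookup (?h d) a else 0)"
    unfolding coeff_sum lookup_sum
    by (intro sum.cong refl, subst monom_mult_homogenize[OF wdeg_weight_component_le])
      (simp_all only: mem_Collect_eq summand not_False_eq_True)
  also have "\<dots> = Poly_Mapping.lookup (?h (weight w a + int j)) a"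
    using finite_weight_component[of w g] by (auto simp: sum.delta)
  also have "\<dots> = Poly_Mapping.lookup (coeff g j) a"
    by (simp add: lookup_weight_component)
  finally show "Poly_Mapping.lookup (coeff ?S j) a = Poly_Mapping.lookup (coeff g j) a" .
qed

section \<open>Membership and torsion modulo the homogenization\<close>

lemma homogenization_ideal:
  "ideal (homogenization w I) (ring_of_type_algebra :: ('n::finite, 'k::comm_ring_1) mpoly poly ring)"
proof -
  interpret ring "ring_of_type_algebra :: ('n, 'k) mpoly poly ring" by rule
  show ?thesis unfolding homogenization_def by (rule genideal_ideal) simp
qed

lemma mem_homogenization_iff:
  fixes I :: "('n::finite, 'k::comm_ring_1) mpoly set"
  assumes "ideal I ring_of_type_algebra"
  shows "g \<in> homogenization w I \<longleftrightarrow> (\<forall>d. weight_component w d g \<in> I)"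
proof
  interpret ring "ring_of_type_algebra :: ('n, 'k) mpoly poly ring" by rule
  note I = ideal_ring_of_type_algebraD[OF assms]
  note H = ideal_ring_of_type_algebraD[OF homogenization_ideal[of w I]]
  let ?J = "{g. \<forall>d. weight_component w d g \<in> I}"
  \<comment> \<open>A term \<open>c x^b t^j\<close> shifts weights and multiplies each component by
    an element of \<open>k[X]\<close>, which keeps it in \<open>I\<close>. So \<open>?J\<close> is
    an ideal, and it remains to see that it contains the generators.\<close>
  have "r * g \<in> ?J" if "g \<in> ?J" for r g
  proof (induction r rule: mpoly_poly_induct)
    case (monom b c j)
    then show ?case using that I(3) by (auto simp: weight_component_monom_mult)
  qed (auto simp: I distrib_right weight_component_add)
  then have "ideal ?J ring_of_type_algebra"
    by (intro ideal_ring_of_type_algebraI) (auto simp: I weight_component_add)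
  moreover have "homogenize w ` I \<subseteq> ?J"
    using I(1) by (auto simp: weight_component_homogenize)
  ultimately have "homogenization w I \<subseteq> ?J"
    unfolding homogenization_def by (rule genideal_minimal)
  then show "\<forall>d. weight_component w d g \<in> I" if "g \<in> homogenization w I"
    using that by blast
  assume g: "\<forall>d. weight_component w d g \<in> I"
  have "homogenize w ` I \<subseteq> homogenization w I"
    unfolding homogenization_def by (rule genideal_self) simp
  \<comment> \<open>Each summand is a multiple of the generator attached to one component, and the
    sum is \<open>g\<close>.\<close>
  then have "(\<Sum>d | weight_component w d g \<noteq> 0. Polynomial.monom 1 (nat (d - wdeg w (weight_component w d g))) *
      homogenize w (weight_component w d g)) \<in> homogenization w I"
    using g by (intro H(5) H(3)) blast
  then show "g \<in> homogenization w I" by (simp add: sum_weight_component)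
qed

text \<open>Constants have weight 0 and \<open>t\<close> has weight 1, so multiplication by
  \<open>p\<close> convolves the components of \<open>g\<close> with the coefficients of
  \<open>p\<close>.\<close>

lemma weight_component_univariate_incl_mult:
  fixes g :: "('n::finite, 'k::comm_ring_1) mpoly poly"
  shows "weight_component w d (univariate_incl p * g) =
    (\<Sum>i\<le>degree p. Poly_Mapping.single 0 (coeff p i) * weight_component w (d - int i) g)"
proof -
  have "(univariate_incl p :: ('n, 'k) mpoly poly) = (\<Sum>i\<le>degree p. Polynomial.monom (Poly_Mapping.single 0 (coeff p i)) i)"
    by (rule poly_eqI)
      (simp add: univariate_incl_def coeff_map_poly coeff_sum coeff_eq_0 not_le)
  then show ?thesis
    by (simp add: sum_distrib_right weight_component_sum weight_component_monom_mult)
      (simp add: weight_def)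
qed

lemma homogenization_torsion_free:
  fixes I :: "('n::finite, 'k::field) mpoly set"
  assumes I: "ideal I ring_of_type_algebra" and "p \<noteq> 0"
    and pg: "univariate_incl p * g \<in> homogenization w I"
  shows "g \<in> homogenization w I"
proof (rule ccontr)
  note IF = ideal_ring_of_type_algebraD[OF I]
  let ?h = "\<lambda>d. weight_component w d g"
  let ?D = "{d. ?h d \<notin> I}"
  assume "g \<notin> homogenization w I"
  then have "?D \<noteq> {}" by (simp add: mem_homogenization_iff[OF I])
  moreover have "finite ?D"
    by (rule finite_subset[OF _ finite_weight_component[of w g]]) (use IF(1) in auto)
  ultimately have d: "Min ?D \<in> ?D" by (intro Min_in)
  have below: "?h e \<in> I" if "e < Min ?D" for e
  proof (rule ccontr)
    assume "?h e \<notin> I"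
    then have "Min ?D \<le> e" using \<open>finite ?D\<close> by (intro Min_le) auto
    then show False using that by simp
  qed
  define d where "d = Min ?D"
  define m where "m = (LEAST i. coeff p i \<noteq> 0)"
  have "\<exists>i. coeff p i \<noteq> 0" using \<open>p \<noteq> 0\<close> by (auto simp: poly_eq_iff)
  then have m: "coeff p m \<noteq> 0" unfolding m_def by (rule LeastI_ex)
  have below_m: "coeff p i = 0" if "i < m" for i
    using not_less_Least[of i "\<lambda>i. coeff p i \<noteq> 0"] that by (simp add: m_def)
  \<comment> \<open>These are the contributions to the component of weight \<open>d + m\<close>. For
    \<open>i < m\<close> the coefficient vanishes, and for \<open>i > m\<close> a component of
    weight below \<open>d\<close> occurs, which lies in \<open>I\<close>; only \<open>i = m\<close>
    is left.\<close>
  let ?t = "\<lambda>i. Poly_Mapping.single 0 (coeff p i) * ?h (d + int m - int i)"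
  have "m \<in> {..degree p}" using m by (simp add: le_degree)
  then have "(\<Sum>i\<le>degree p. ?t i) = ?t m + (\<Sum>i\<in>{..degree p} - {m}. ?t i)"
    by (simp add: sum.remove)
  moreover have "(\<Sum>i\<le>degree p. ?t i) \<in> I"
    unfolding weight_component_univariate_incl_mult[symmetric]
    using pg mem_homogenization_iff[OF I] by blast
  moreover have "(\<Sum>i\<in>{..degree p} - {m}. ?t i) \<in> I"
  proof (rule IF(5))
    fix i assume "i \<in> {..degree p} - {m}"
    then consider "i < m" | "m < i" by force
    then show "?t i \<in> I"
    proof cases
      case 1
      then show ?thesis using below_m IF(1) by simp
    next
      case 2
      then show ?thesis by (intro IF(3) below) (simp add: d_def)
    qed
  qed
  ultimately have "?t m + (\<Sum>i\<in>{..degree p} - {m}. ?t i) - (\<Sum>i\<in>{..degree p} - {m}. ?t i) \<in> I"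
    by (intro IF(4)) simp_all
  then have "?t m \<in> I" by (simp only: add_diff_cancel_right')
  \<comment> \<open>Here the coefficients have to form a field: the surviving multiple of
    \<open>?h d\<close> is divided by the scalar \<open>coeff p m\<close>.\<close>
  then have "Poly_Mapping.single 0 (inverse (coeff p m)) * ?t m \<in> I" by (rule IF(3))
  moreover have "Poly_Mapping.single 0 (inverse (coeff p m)) * ?t m = ?h d"
    using m by (simp add: mult.assoc[symmetric] mult_single)
  ultimately show False using d by (simp add: d_def)
qed

section \<open>The quotient as a module over \<open>k[t]\<close>\<close>

lemma univariate_incl_hom:
  "univariate_incl \<in> ring_hom ring_of_type_algebra (ring_of_type_algebra :: ('n, 'k::comm_ring_1) mpoly poly ring)"
proof (rule ring_hom_memI)
  fix p q :: "'k poly"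
  have 1: "univariate_incl (p + q) = (univariate_incl p + univariate_incl q :: ('n, 'k) mpoly poly)" for p q
    by (rule poly_eqI) (simp add: univariate_incl_def coeff_map_poly single_add)
  have single_sum: "Poly_Mapping.single 0 (sum f A) = (\<Sum>i\<in>A. Poly_Mapping.single (0 :: 'n \<Rightarrow>\<^sub>0 nat) (f i :: 'k))"
    for f and A :: "nat set"
    by (induction A rule: infinite_finite_induct) (auto simp: single_add)
  have 2: "univariate_incl (p * q) = (univariate_incl p * univariate_incl q :: ('n, 'k) mpoly poly)"
    by (rule poly_eqI) (simp add: univariate_incl_def coeff_map_poly coeff_mult single_sum mult_single)
  show "univariate_incl (p \<otimes>\<^bsub>ring_of_type_algebra\<^esub> q) =
      (univariate_incl p \<otimes>\<^bsub>ring_of_type_algebra\<^esub> univariate_incl q :: ('n, 'k) mpoly poly)"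
    using 2 by simp
  show "univariate_incl (p \<oplus>\<^bsub>ring_of_type_algebra\<^esub> q) =
      (univariate_incl p \<oplus>\<^bsub>ring_of_type_algebra\<^esub> univariate_incl q :: ('n, 'k) mpoly poly)"
    using 1 by simp
qed (simp_all add: univariate_incl_def)

lemma module_via_module:
  assumes "cring A" "cring S" and h: "h \<in> ring_hom A S"
  shows "Module.module A (module_via S h)"
proof -
  interpret A: cring A by fact
  interpret S: cring S by fact
  have h_closed: "h a \<in> carrier S" if "a \<in> carrier A" for a
    using h that by (rule ring_hom_closed)
  show ?thesis
  proof (rule moduleI)
    show "abelian_group (module_via S h)"
      by (rule abelian_groupI)
        (auto simp: module_via_def S.a_ac intro: bexI[of _ "\<ominus>\<^bsub>S\<^esub> _"] S.l_neg)
  qed (use assms in \<open>auto simp: module_via_def h_closed ring_hom_add[OF h] ring_hom_mult[OF h]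
      ring_hom_one[OF h] S.l_distr S.r_distr S.m_assoc\<close>)
qed

theorem proposition3p4:
  fixes w :: "'n::finite \<Rightarrow> int"
    and I :: "('n, 'k::field) mpoly set"
  assumes "ideal I ring_of_type_algebra"
  shows "flat_extension
           (ring_of_type_algebra :: 'k poly ring)
           ((ring_of_type_algebra :: ('n, 'k) mpoly poly ring) Quot homogenization w I)
           (\<lambda>p. homogenization w I +>\<^bsub>ring_of_type_algebra\<^esub> univariate_incl p)
           TYPE('b) TYPE('c)"
proof -
  let ?A = "ring_of_type_algebra :: 'k poly ring"
  let ?R = "ring_of_type_algebra :: ('n, 'k) mpoly poly ring"
  let ?H = "homogenization w I"
  let ?h = "\<lambda>p. ?H +>\<^bsub>?R\<^esub> univariate_incl p"
  interpret R: cring ?R by rule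
  interpret H: ideal ?H ?R by (rule homogenization_ideal)
  have Q: "cring (?R Quot ?H)" by (rule H.quotient_is_cring) (rule R.is_cring)
  have hom: "?h \<in> ring_hom ?A (?R Quot ?H)"
    using ring_hom_trans[OF univariate_incl_hom H.rcos_ring_hom] by (simp add: comp_def)
  have M: "Module.module ?A (module_via (?R Quot ?H) ?h)"
    by (rule module_via_module[OF _ Q hom]) rule
  have "flat_module ?A (module_via (?R Quot ?H) ?h) TYPE('b) TYPE('c)"
  proof (rule torsion_free_imp_flat[OF euclidean_domain_poly M])
    fix p C
    assume "C \<in> carrier (module_via (?R Quot ?H) ?h)"
      and 0: "p \<odot>\<^bsub>module_via (?R Quot ?H) ?h\<^esub> C = \<zero>\<^bsub>module_via (?R Quot ?H) ?h\<^esub>"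
    then obtain g where C: "C = ?H +>\<^bsub>?R\<^esub> g"
      by (auto simp: module_via_def FactRing_def A_RCOSETS_def')
    \<comment> \<open>The scalar action is multiplication of cosets and the zero of the quotient is
      \<open>?H\<close> itself, so torsion in the quotient becomes a membership statement in
      \<open>k[X,t]\<close>.\<close>
    have "?H +>\<^bsub>?R\<^esub> (univariate_incl p * g) = ?H"
      using 0 H.rcoset_mult_add[of "univariate_incl p" g]
      by (simp add: C module_via_def FactRing_def)
    then have "univariate_incl p * g \<in> ?H"
      using H.a_rcos_self[of "univariate_incl p * g"] by simp
    then have "p = 0 \<or> g \<in> ?H"
      using homogenization_torsion_free[OF assms] by blast
    then show "p = \<zero>\<^bsub>?A\<^esub> \<or> C = \<zero>\<^bsub>module_via (?R Quot ?H) ?h\<^esub>"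
      using H.a_rcos_const[of g] by (auto simp: C module_via_def FactRing_def)
  qed
  then show ?thesis using hom by (simp add: flat_extension_def)
qed

end
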